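(* Let $n\ge 4$ and let $(\pi,V)$ be a real representation of the alternating group $A_n$. Put $h_\pi=\frac{\chi_\pi(1)-\chi_\pi(s_1s_3)}{2}$, where $s_1s_3=(1,2)(3,4)$. Then $\pi$ is spinorial if and only if $h_\pi$ is a multiple of $4$. In this case $\pi$ has a unique lift.
   Context: A real representation of a finite group $G$ on a Euclidean space $V$ is regarded as a homomorphism $\pi:G\to\mathrm{O}(V)$; $\chi_\pi$ is its character. $\mathrm{Pin}(V)$ is the Pin group of $V$ (from the Clifford algebra with $v^2=-|v|^2$) with standard double cover $\rho:\mathrm{Pin}(V)\to\mathrm{O}(V)$, kernel $\{\pm1\}$. $\pi$ is spinorial if there is a homomorphism $\hat\pi:G\to\mathrm{Pin}(V)$ (a lift) with $\rho\circ\hat\pi=\pi$. *)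

theory Defs
  imports "HOL-Algebra.Sym_Groups" "HOL-Combinatorics.Transposition" "Jordan_Normal_Form.Matrix"
begin

text \<open>A Euclidean space V of dimension d is identified (isometrically) with R^d,
  realised as JNF vectors of dimension d; O(V) is the group of orthogonal d x d matrices.\<close>

definition mat_trace :: "real mat \<Rightarrow> real" where
  "mat_trace A = (\<Sum>i<dim_row A. A $$ (i, i))"

definition orth_mat :: "nat \<Rightarrow> real mat \<Rightarrow> bool" where
  "orth_mat d A \<longleftrightarrow> A \<in> carrier_mat d d \<and> transpose_mat A * A = 1\<^sub>m d"

definition real_orth_rep :: "('g, 'b) monoid_scheme \<Rightarrow> nat \<Rightarrow> ('g \<Rightarrow> real mat) \<Rightarrow> bool" where
  "real_orth_rep G d \<pi> \<longleftrightarrow>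
     (\<forall>g\<in>carrier G. orth_mat d (\<pi> g)) \<and>
     (\<forall>g\<in>carrier G. \<forall>h\<in>carrier G. \<pi> (g \<otimes>\<^bsub>G\<^esub> h) = \<pi> g * \<pi> h)"

definition character :: "('g \<Rightarrow> real mat) \<Rightarrow> 'g \<Rightarrow> real" where
  "character \<pi> g = mat_trace (\<pi> g)"

section \<open>The Clifford algebra Cl(R^d) with v^2 = -|v|^2\<close>

text \<open>Elements are coefficient functions on the basis e_S, S a subset of {0..<d}
  (e_S = e_{i1} ... e_{ik}, i1 < ... < ik), with e_i e_j = - e_j e_i (i \<noteq> j), e_i^2 = -1.\<close>

type_synonym cliff = "nat set \<Rightarrow> real"

definition cl_sign :: "nat set \<Rightarrow> nat set \<Rightarrow> real" where
  "cl_sign A B = (-1) ^ (card {(i, j). i \<in> A \<and> j \<in> B \<and> j < i} + card (A \<inter> B))"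

definition cl_mult :: "nat \<Rightarrow> cliff \<Rightarrow> cliff \<Rightarrow> cliff" where
  "cl_mult d x y S =
     (\<Sum>A\<in>Pow {..<d}. \<Sum>B\<in>Pow {..<d}.
        if (A - B) \<union> (B - A) = S then cl_sign A B * x A * y B else 0)"

definition cl_one :: cliff where
  "cl_one S = (if S = {} then 1 else 0)"

definition cl_vec :: "nat \<Rightarrow> real vec \<Rightarrow> cliff" where
  "cl_vec d v S = (if \<exists>i<d. S = {i} then v $ (THE i. S = {i}) else 0)"

definition cl_alpha :: "cliff \<Rightarrow> cliff" where
  "cl_alpha x S = (-1) ^ card S * x S"

definition unit_vec :: "nat \<Rightarrow> real vec \<Rightarrow> bool" where
  "unit_vec d u \<longleftrightarrow> u \<in> carrier_vec d \<and> (\<Sum>i<d. (u $ i)^2) = 1"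

text \<open>Pin(V): the subgroup of units of Cl(V) generated by the unit vectors
  (closed under inverses since u^{-1} = -u is again a unit vector).\<close>
definition Pin :: "nat \<Rightarrow> cliff set" where
  "Pin d = {foldr (cl_mult d) (map (cl_vec d) us) cl_one | us. \<forall>u\<in>set us. unit_vec d u}"

text \<open>The double cover rho : Pin(V) -> O(V), rho(x) v = alpha(x) v x^{-1}.\<close>
definition pin_rho :: "nat \<Rightarrow> cliff \<Rightarrow> real mat" where
  "pin_rho d x = (THE A. A \<in> carrier_mat d d \<and>
      (\<forall>v\<in>carrier_vec d. cl_mult d (cl_alpha x) (cl_vec d v) = cl_mult d (cl_vec d (A *\<^sub>v v)) x))"

definition is_pin_lift :: "('g, 'b) monoid_scheme \<Rightarrow> nat \<Rightarrow> ('g \<Rightarrow> real mat) \<Rightarrow> ('g \<Rightarrow> cliff) \<Rightarrow> bool" where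
  "is_pin_lift G d \<pi> f \<longleftrightarrow>
     (\<forall>g\<in>carrier G. f g \<in> Pin d \<and> pin_rho d (f g) = \<pi> g) \<and>
     (\<forall>g\<in>carrier G. \<forall>h\<in>carrier G. f (g \<otimes>\<^bsub>G\<^esub> h) = cl_mult d (f g) (f h))"

definition spinorial :: "('g, 'b) monoid_scheme \<Rightarrow> nat \<Rightarrow> ('g \<Rightarrow> real mat) \<Rightarrow> bool" where
  "spinorial G d \<pi> \<longleftrightarrow> (\<exists>f. is_pin_lift G d \<pi> f)"

definition s1s3 :: "nat \<Rightarrow> nat" where
  "s1s3 = transpose 1 2 \<circ> transpose 3 4"

end

theory Submission
  imports Defs "Jordan_Normal_Form.Determinant"
begin

text \<open>Let \<open>h\<close> be the multiplicity of the eigenvalue \<open>-1\<close> of the involution \<open>\<pi>(s\<^sub>1s\<^sub>3)\<close>. A lift of it to the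
  Pin group is a product of \<open>h\<close> orthonormal vectors, whose square is \<open>(-1)\<close> to the power \<open>h(h+1)/2\<close>.
  Moreover \<open>h\<close> is even, because \<open>s\<^sub>1s\<^sub>3\<close> is a product of two 3-cycles and elements of order 3 lift to
  even elements. So the square of the lift is \<open>1\<close> exactly when \<open>4\<close> divides \<open>h\<close>, and this is
  necessary for a homomorphic lift to exist. For the converse, the 3-cycles \<open>x\<^sub>i = (1 2 i)\<close>
  always have lifts \<open>X\<^sub>i\<close> of order 3, and every \<open>x\<^sub>i x\<^sub>j\<close> is conjugate to \<open>s\<^sub>1s\<^sub>3\<close>, so that
  \<open>(X\<^sub>i X\<^sub>j)\<^sup>2 = 1\<close>; these are the defining relations of \<open>A\<^sub>n\<close>. Two lifts differ by signs, which
  are trivial on each \<open>x\<^sub>i = (x\<^sub>i\<^sup>2)\<^sup>2\<close>.\<close>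

section \<open>The Clifford algebra\<close>

text \<open>What has to be excluded in the converse is a word in the lifts \<open>X\<^sub>i\<close>
  that lies over the identity permutation but equals -1. Knowing the relations is not enough; they
  must be shown to leave no more words than there are even permutations. This is done by coset
  enumeration inside the pullback of the double cover: the words in X_3, ..., X_k are covered by k
  cosets of the words in X_3, ..., X_(k-1), and the representatives other than 1 move the point k.
  Since each X_i has order 3, its inverse is again a word, so the whole argument runs in a monoid.

  The sign ambiguity of a lift disappears in every square, which makes the square of a lift an
  invariant of the element, and even of its conjugacy class in the alternating group. Conjugation in
  the full symmetric group would not do, because only even permutations act on V and so have
  lifts.\<close>

lemma cl_sign_prod:
  assumes "finite A" "finite B"
  shows "cl_sign A B = (\<Prod>i\<in>A. \<Prod>j\<in>B. if j \<le> i then -1 else 1)"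
proof -
  let ?L = "{(i, j). i \<in> A \<and> j \<in> B \<and> j < i}" and ?E = "(\<lambda>i. (i, i)) ` (A \<inter> B)"
  have fin: "finite ?L" "finite ?E"
    using assms by (auto intro: finite_subset[of _ "A \<times> B"])
  have "card (A \<inter> B) = card ?E"
    by (simp add: card_image inj_on_def)
  then have "card ?L + card (A \<inter> B) = card (?L \<union> ?E)"
    using card_Un_disjoint[OF fin] by force
  \<comment> \<open>A transposed pair j < i and a repeated index
    \<open>e\<^sub>i\<^sup>2 = -1\<close> each cost one sign, so together they are the pairs with j
    \<le> i.\<close>
  also have "?L \<union> ?E = {p \<in> A \<times> B. snd p \<le> fst p}"
    by auto
  finally have "cl_sign A B = (\<Prod>p\<in>{p \<in> A \<times> B. snd p \<le> fst p}. -1)"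
    by (simp add: cl_sign_def)
  also have "\<dots> = (\<Prod>p\<in>A \<times> B. if snd p \<le> fst p then -1 else 1)"
    using assms by (intro prod.inter_filter) simp
  finally show ?thesis
    by (simp add: prod.cartesian_product split_def)
qed

text \<open>Points of the intersection occur twice on the right and contribute
  \<open>f x * f x = 1\<close>. Thus a sign-valued \<open>prod f\<close> is a homomorphism on finite
  sets under symmetric difference.\<close>

lemma prod_sym_diff:
  fixes f :: "'a \<Rightarrow> 'b::comm_monoid_mult"
  assumes "finite A" "finite B" "\<And>x. f x * f x = 1"
  shows "prod f (sym_diff A B) = prod f A * prod f B"
proof -
  have split: "prod f X = prod f (X - Y) * prod f (X \<inter> Y)" if "finite X" for X Y
    using that by (metis mult.commute prod.Int_Diff)
  have "prod f (A \<inter> B) * prod f (A \<inter> B) = 1"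
    by (simp add: assms flip: prod.distrib)
  then have "prod f A * prod f B = prod f (A - B) * prod f (B - A)"
    using split[OF assms(1), of B] split[OF assms(2), of A]
    by (metis (no_types, lifting) Int_commute mult.assoc mult.left_commute mult.right_neutral)
  moreover have "prod f (sym_diff A B) = prod f (A - B) * prod f (B - A)"
    using assms by (intro prod.union_disjoint) auto
  ultimately show ?thesis by simp
qed

lemma minus_one_power_card_sym_diff:
  assumes "finite A" "finite B"
  shows "(-1::real) ^ card (sym_diff A B) = (-1) ^ card A * (-1) ^ card B"
  using prod_sym_diff[OF assms, of "\<lambda>_. -1::real"] by simp

text \<open>With its counterpart for the second argument this makes \<open>cl_sign\<close>
  bimultiplicative, hence a 2-cocycle on the group of finite sets under symmetric difference. The
  Clifford algebra is the group algebra twisted by this cocycle.\<close>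

lemma cl_sign_sym_diff_left:
  assumes "finite A" "finite B" "finite C"
  shows "cl_sign (sym_diff A B) C = cl_sign A C * cl_sign B C"
proof -
  have "(\<Prod>j\<in>C. if j \<le> i then -1 else 1) * (\<Prod>j\<in>C. if j \<le> i then -1 else 1) = (1::real)" for i
    unfolding prod.distrib[symmetric] by (rule prod.neutral) auto
  then show ?thesis
    using assms by (simp add: cl_sign_prod prod_sym_diff)
qed

lemma cl_sign_sym_diff_right:
  assumes "finite A" "finite B" "finite C"
  shows "cl_sign A (sym_diff B C) = cl_sign A B * cl_sign A C"
proof -
  have "(\<Prod>j\<in>sym_diff B C. if j \<le> i then -1 else 1)
     = (\<Prod>j\<in>B. if j \<le> i then -1 else (1::real)) * (\<Prod>j\<in>C. if j \<le> i then -1 else 1)" for i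
    using assms by (intro prod_sym_diff) auto
  then show ?thesis
    using assms by (simp add: cl_sign_prod prod.distrib)
qed

lemma cl_sign_square: "cl_sign A B * cl_sign A B = 1"
  by (simp add: cl_sign_def flip: power_mult_distrib)

lemma cl_sign_empty [simp]: "cl_sign {} B = 1" "cl_sign A {} = 1"
  by (simp_all add: cl_sign_def)

lemma cl_sign_singletons: "cl_sign {i} {j} = (if j \<le> i then -1 else 1)"
  by (simp add: cl_sign_prod)

section \<open>Associativity and unit of the Clifford product\<close>

lemma sym_diff_eq_iff: "sym_diff A B = S \<longleftrightarrow> B = sym_diff A S"
  by blast

text \<open>For given A and S a single B contributes to the double sum. The version indexed by the
  right factor is needed as well, so that a nested product can be expanded on either side.\<close>

lemma cl_mult_left_sum:
  "cl_mult d x y S = (if S \<subseteq> {..<d} then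
     \<Sum>A\<in>Pow {..<d}. cl_sign A (sym_diff A S) * x A * y (sym_diff A S) else 0)"
proof (cases "S \<subseteq> {..<d}")
  case True
  have "(\<Sum>B\<in>Pow {..<d}. if sym_diff A B = S then cl_sign A B * x A * y B else 0)
      = cl_sign A (sym_diff A S) * x A * y (sym_diff A S)" if "A \<in> Pow {..<d}" for A
  proof -
    have "sym_diff A S \<in> Pow {..<d}" using that True by auto
    then show ?thesis by (simp add: sym_diff_eq_iff sum.delta)
  qed
  then show ?thesis using True by (simp add: cl_mult_def)
next
  case False
  have "(if sym_diff A B = S then cl_sign A B * x A * y B else 0) = 0"
    if "A \<in> Pow {..<d}" "B \<in> Pow {..<d}" for A B
    using that False by auto
  then show ?thesis using False unfolding cl_mult_def by (simp add: sum.neutral)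
qed

lemma cl_mult_right_sum:
  "cl_mult d x y S = (if S \<subseteq> {..<d} then
     \<Sum>B\<in>Pow {..<d}. cl_sign (sym_diff B S) B * x (sym_diff B S) * y B else 0)"
proof -
  have "(\<Sum>A\<in>Pow {..<d}. cl_sign A (sym_diff A S) * x A * y (sym_diff A S))
      = (\<Sum>B\<in>Pow {..<d}. cl_sign (sym_diff B S) B * x (sym_diff B S) * y B)"
    if "S \<subseteq> {..<d}"
  proof (rule sum.reindex_bij_witness[of _ "\<lambda>B. sym_diff B S" "\<lambda>A. sym_diff A S"])
    fix A assume "A \<in> Pow {..<d}"
    show eq: "sym_diff (sym_diff A S) S = A" by blast
    show "sym_diff A S \<in> Pow {..<d}" using that \<open>A \<in> _\<close> by blast
    show "cl_sign (sym_diff (sym_diff A S) S) (sym_diff A S) * x (sym_diff (sym_diff A S) S) * y (sym_diff A S)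
      = cl_sign A (sym_diff A S) * x A * y (sym_diff A S)"
      unfolding eq ..
  next
    fix A assume "A \<in> Pow {..<d}"
    show "sym_diff (sym_diff A S) S = A" by blast
    show "sym_diff A S \<in> Pow {..<d}" using that \<open>A \<in> _\<close> by blast
  qed
  then show ?thesis by (simp add: cl_mult_left_sum)
qed

lemma cl_mult_assoc: "cl_mult d (cl_mult d x y) z = cl_mult d x (cl_mult d y z)"
proof
  fix S
  show "cl_mult d (cl_mult d x y) z S = cl_mult d x (cl_mult d y z) S"
  proof (cases "S \<subseteq> {..<d}")
    case True
    let ?D = "Pow {..<d}"
    have fin: "finite X" if "X \<in> ?D" for X
      using that finite_subset by auto
    have sub: "sym_diff C S \<subseteq> {..<d}" if "C \<in> ?D" for C
      using that True by auto
    have "cl_mult d (cl_mult d x y) z S = (\<Sum>C\<in>?D. \<Sum>A\<in>?D.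
       cl_sign (sym_diff C S) C * (cl_sign A (sym_diff A (sym_diff C S)) * x A * y (sym_diff A (sym_diff C S))) * z C)"
      unfolding cl_mult_right_sum[of d "cl_mult d x y"] if_P[OF True]
    proof (rule sum.cong[OF refl])
      fix C assume "C \<in> ?D"
      then show "cl_sign (sym_diff C S) C * cl_mult d x y (sym_diff C S) * z C = (\<Sum>A\<in>?D.
        cl_sign (sym_diff C S) C * (cl_sign A (sym_diff A (sym_diff C S)) * x A * y (sym_diff A (sym_diff C S))) * z C)"
        unfolding cl_mult_left_sum[of d x y] if_P[OF sub[OF \<open>C \<in> ?D\<close>]]
        by (simp only: sum_distrib_left sum_distrib_right)
    qed
    also have "\<dots> = (\<Sum>A\<in>?D. \<Sum>C\<in>?D.
       cl_sign (sym_diff C S) C * (cl_sign A (sym_diff A (sym_diff C S)) * x A * y (sym_diff A (sym_diff C S))) * z C)"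
      by (rule sum.swap)
    also have "\<dots> = (\<Sum>A\<in>?D. \<Sum>C\<in>?D.
       cl_sign A (sym_diff A S) * x A * (cl_sign (sym_diff C (sym_diff A S)) C * y (sym_diff C (sym_diff A S)) * z C))"
    proof (intro sum.cong refl)
      fix A C assume A: "A \<in> ?D" and C: "C \<in> ?D"
      define B where "B = sym_diff A (sym_diff C S)"
      have B: "B \<in> ?D" using True A C by (auto simp: B_def)
      have eqs: "sym_diff C (sym_diff A S) = B" "sym_diff C S = sym_diff A B"
        "sym_diff A S = sym_diff B C"
        by (auto simp: B_def)
      \<comment> \<open>The cocycle identity; both sides are the product of the signs of (A, B), (A,
        C) and (B, C).\<close>
      have "cl_sign (sym_diff A B) C * cl_sign A B = cl_sign A (sym_diff B C) * cl_sign B C"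
        using A B C fin by (simp add: cl_sign_sym_diff_left cl_sign_sym_diff_right)
      then show "cl_sign (sym_diff C S) C * (cl_sign A (sym_diff A (sym_diff C S)) * x A * y (sym_diff A (sym_diff C S))) * z C
        = cl_sign A (sym_diff A S) * x A * (cl_sign (sym_diff C (sym_diff A S)) C * y (sym_diff C (sym_diff A S)) * z C)"
        unfolding eqs(1) B_def[symmetric] unfolding eqs(2,3) by (simp add: algebra_simps)
    qed
    also have "\<dots> = cl_mult d x (cl_mult d y z) S"
      unfolding cl_mult_left_sum[of d x "cl_mult d y z"] if_P[OF True]
    proof (rule sum.cong[OF refl])
      fix A assume "A \<in> ?D"
      then show "(\<Sum>C\<in>?D.
         cl_sign A (sym_diff A S) * x A * (cl_sign (sym_diff C (sym_diff A S)) C * y (sym_diff C (sym_diff A S)) * z C))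
        = cl_sign A (sym_diff A S) * x A * cl_mult d y z (sym_diff A S)"
        unfolding cl_mult_right_sum[of d y z] if_P[OF sub[OF \<open>A \<in> ?D\<close>]]
        by (simp only: sum_distrib_left)
    qed
    finally show ?thesis .
  qed (simp add: cl_mult_left_sum)
qed

text \<open>The type \<open>cliff\<close> does not know d, and \<open>cl_mult d\<close> discards
  coefficients at sets outside the range, so \<open>cl_one\<close> is neutral only on this
  subspace.\<close>

definition cl_carrier :: "nat \<Rightarrow> cliff set" where
  "cl_carrier d = {x. \<forall>S. \<not> S \<subseteq> {..<d} \<longrightarrow> x S = 0}"

definition cl_scale :: "real \<Rightarrow> cliff \<Rightarrow> cliff" where
  "cl_scale c x S = c * x S"

lemma cl_scale_simps [simp]:
  "cl_mult d (cl_scale c x) y = cl_scale c (cl_mult d x y)"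
  "cl_mult d x (cl_scale c y) = cl_scale c (cl_mult d x y)"
  "cl_scale c (cl_scale b x) = cl_scale (c * b) x"
  "cl_scale 1 x = x"
  by (auto simp: cl_scale_def cl_mult_left_sum sum_distrib_left algebra_simps intro!: ext sum.cong)

lemma cl_scale_eq_iff [simp]: "cl_scale c x = cl_scale c y \<longleftrightarrow> c = 0 \<or> x = y"
  by (auto simp: cl_scale_def fun_eq_iff)

lemma cl_mult_carrier [simp]: "cl_mult d x y \<in> cl_carrier d"
  by (simp add: cl_carrier_def cl_mult_left_sum)

lemma cl_one_carrier [simp]: "cl_one \<in> cl_carrier d"
  by (auto simp: cl_carrier_def cl_one_def)

lemma cl_vec_carrier [simp]: "cl_vec d v \<in> cl_carrier d"
  by (auto simp: cl_carrier_def cl_vec_def)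

lemma cl_mult_one_left [simp]:
  assumes "x \<in> cl_carrier d"
  shows "cl_mult d cl_one x = x"
proof
  fix S
  have "(\<Sum>A\<in>Pow {..<d}. cl_sign A (sym_diff A S) * cl_one A * x (sym_diff A S))
      = (\<Sum>A\<in>Pow {..<d}. if A = {} then x S else 0)"
    by (intro sum.cong) (auto simp: cl_one_def)
  then show "cl_mult d cl_one x S = x S"
    using assms by (simp add: cl_mult_left_sum cl_carrier_def)
qed

lemma cl_mult_one_right [simp]:
  assumes "x \<in> cl_carrier d"
  shows "cl_mult d x cl_one = x"
proof
  fix S
  have "(\<Sum>B\<in>Pow {..<d}. cl_sign (sym_diff B S) B * x (sym_diff B S) * cl_one B)
      = (\<Sum>B\<in>Pow {..<d}. if B = {} then x S else 0)"
    by (intro sum.cong) (auto simp: cl_one_def)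
  then show "cl_mult d x cl_one S = x S"
    using assms by (simp add: cl_mult_right_sum cl_carrier_def)
qed

section \<open>The grading automorphism and Clifford conjugation\<close>

lemma cl_alpha_mult: "cl_alpha (cl_mult d x y) = cl_mult d (cl_alpha x) (cl_alpha y)"
proof
  fix S
  show "cl_alpha (cl_mult d x y) S = cl_mult d (cl_alpha x) (cl_alpha y) S"
  proof (cases "S \<subseteq> {..<d}")
    case True
    have "(-1) ^ card S = (-1::real) ^ card A * (-1) ^ card (sym_diff A S)" if "A \<in> Pow {..<d}" for A
    proof -
      have "finite A" "finite S" using that True finite_subset by auto
      then have "(-1::real) ^ card (sym_diff A (sym_diff A S)) = (-1) ^ card A * (-1) ^ card (sym_diff A S)"
        by (intro minus_one_power_card_sym_diff) auto
      moreover have "sym_diff A (sym_diff A S) = S" by blast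
      ultimately show ?thesis by simp
    qed
    then have "(-1) ^ card S * (cl_sign A (sym_diff A S) * x A * y (sym_diff A S))
      = cl_sign A (sym_diff A S) * cl_alpha x A * cl_alpha y (sym_diff A S)" if "A \<in> Pow {..<d}" for A
      using that by (simp add: cl_alpha_def)
    then show ?thesis
      unfolding cl_alpha_def[of "cl_mult d x y"] cl_mult_left_sum if_P[OF True] sum_distrib_left
      by (intro sum.cong refl)
  qed (simp add: cl_alpha_def cl_mult_left_sum)
qed

lemma cl_alpha_one [simp]: "cl_alpha cl_one = cl_one"
  by (auto simp: cl_alpha_def cl_one_def)

lemma cl_alpha_scale [simp]: "cl_alpha (cl_scale c x) = cl_scale c (cl_alpha x)"
  by (auto simp: cl_alpha_def cl_scale_def)

lemma cl_alpha_vec: "cl_alpha (cl_vec d v) = cl_scale (-1) (cl_vec d v)"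
  by (auto simp: cl_alpha_def cl_scale_def cl_vec_def intro!: ext)

text \<open>Since \<open>cl_sign S S\<close> is the scalar \<open>e\<^sub>S * e\<^sub>S\<close>, this is the linear map with \<open>e\<^sub>S \<mapsto> e\<^sub>S\<^sup>-\<^sup>1\<close>.\<close>
definition cl_star :: "cliff \<Rightarrow> cliff" where
  "cl_star x S = cl_sign S S * x S"

lemma cl_star_mult: "cl_star (cl_mult d x y) = cl_mult d (cl_star y) (cl_star x)"
proof
  fix S
  show "cl_star (cl_mult d x y) S = cl_mult d (cl_star y) (cl_star x) S"
  proof (cases "S \<subseteq> {..<d}")
    case True
    have "cl_sign S S * cl_sign A (sym_diff A S)
        = cl_sign (sym_diff A S) A * (cl_sign (sym_diff A S) (sym_diff A S) * cl_sign A A)"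
      if "A \<in> Pow {..<d}" for A
    proof -
      define B where "B = sym_diff A S"
      have S: "S = sym_diff A B" by (auto simp: B_def)
      have "finite A" "finite S" using that True finite_subset by auto
      then have fin: "finite A" "finite B" by (auto simp: B_def)
      have "cl_sign S S = cl_sign A A * cl_sign A B * (cl_sign B A * cl_sign B B)"
        using fin by (simp add: S cl_sign_sym_diff_left cl_sign_sym_diff_right)
      \<comment> \<open>The sign of (A, B) occurs once in the expansion of
        \<open>cl_sign S S\<close> and once as the factor of the product, so it cancels and only the
        sign of the reversed pair remains.\<close>
      then have "cl_sign S S * cl_sign A B = cl_sign B A * (cl_sign B B * cl_sign A A) * (cl_sign A B * cl_sign A B)"
        by (simp add: algebra_simps)
      then show ?thesis
        unfolding B_def[symmetric] by (simp add: cl_sign_square)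
    qed
    then have "cl_sign S S * (cl_sign A (sym_diff A S) * x A * y (sym_diff A S))
      = cl_sign (sym_diff A S) A * cl_star y (sym_diff A S) * cl_star x A"
      if "A \<in> Pow {..<d}" for A
      using that by (simp add: cl_star_def mult.assoc[symmetric])
    then show ?thesis
      unfolding cl_star_def[of "cl_mult d x y"] cl_mult_left_sum[of d x y]
        cl_mult_right_sum[of d "cl_star y"] if_P[OF True] sum_distrib_left
      by (intro sum.cong refl)
  qed (simp add: cl_star_def cl_mult_left_sum)
qed

lemma cl_star_one [simp]: "cl_star cl_one = cl_one"
  by (auto simp: cl_star_def cl_one_def)

lemma cl_star_vec: "cl_star (cl_vec d v) = cl_scale (-1) (cl_vec d v)"
  by (auto simp: cl_star_def cl_scale_def cl_vec_def cl_sign_singletons intro!: ext)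

section \<open>Vectors inside the Clifford algebra\<close>

lemma cl_vec_singleton [simp]: "i < d \<Longrightarrow> cl_vec d v {i} = v $ i"
  by (auto simp: cl_vec_def)

lemma cl_vec_inj:
  assumes "cl_vec d v = cl_vec d w" "v \<in> carrier_vec d" "w \<in> carrier_vec d"
  shows "v = w"
  using assms by (metis carrier_vecD cl_vec_singleton eq_vecI)

lemma cl_vec_scale:
  assumes "v \<in> carrier_vec d"
  shows "cl_vec d (c \<cdot>\<^sub>v v) = cl_scale c (cl_vec d v)"
proof
  fix S
  show "cl_vec d (c \<cdot>\<^sub>v v) S = cl_scale c (cl_vec d v) S"
    using assms by (cases "\<exists>i<d. S = {i}") (auto simp: cl_scale_def cl_vec_def)
qed

lemma cl_vec_minus:
  assumes "v \<in> carrier_vec d" "w \<in> carrier_vec d"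
  shows "cl_vec d (v - w) S = cl_vec d v S - cl_vec d w S"
  using assms by (cases "\<exists>i<d. S = {i}") (auto simp: cl_vec_def)

lemma sum_cl_vec: "(\<Sum>A\<in>Pow {..<d}. cl_vec d v A * g A) = (\<Sum>i<d. v $ i * g {i})"
proof -
  have "(\<Sum>A\<in>Pow {..<d}. cl_vec d v A * g A) = (\<Sum>A\<in>(\<lambda>i. {i}) ` {..<d}. cl_vec d v A * g A)"
    by (intro sum.mono_neutral_right) (auto simp: cl_vec_def)
  also have "\<dots> = (\<Sum>i<d. v $ i * g {i})"
    by (simp add: sum.reindex)
  finally show ?thesis .
qed

lemma cl_mult_vec_vec:
  "cl_mult d (cl_vec d u) (cl_vec d v) S
    = (\<Sum>i<d. \<Sum>j<d. u $ i * v $ j * (if sym_diff {i} {j} = S then cl_sign {i} {j} else 0))"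
proof -
  have "cl_mult d (cl_vec d u) (cl_vec d v) S = (\<Sum>A\<in>Pow {..<d}. cl_vec d u A * (\<Sum>B\<in>Pow {..<d}.
     cl_vec d v B * (if sym_diff A B = S then cl_sign A B else 0)))"
    unfolding cl_mult_def sum_distrib_left by (intro sum.cong refl) auto
  then show ?thesis
    by (simp only: sum_cl_vec) (simp add: sum_distrib_left mult.assoc)
qed

text \<open>The polarised form uv + vu = -2(u, v) of the defining relation: the terms (i, j) and (j,
  i) cancel off the diagonal and add up on it.\<close>

lemma cl_vec_anticommute:
  "cl_mult d (cl_vec d u) (cl_vec d v) S + cl_mult d (cl_vec d v) (cl_vec d u) S
    = - 2 * (\<Sum>i<d. u $ i * v $ i) * cl_one S"
proof -
  let ?e = "\<lambda>i j. if sym_diff {i} {j} = S then cl_sign {i} {j} else 0"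
  have e: "?e i j + ?e j i = (if i = j then - 2 * cl_one S else 0)" for i j :: nat
    by (auto simp: cl_sign_singletons cl_one_def)
  have "cl_mult d (cl_vec d v) (cl_vec d u) S = (\<Sum>i<d. \<Sum>j<d. u $ i * v $ j * ?e j i)"
    unfolding cl_mult_vec_vec by (subst sum.swap) (simp only: mult.commute)
  then have "cl_mult d (cl_vec d u) (cl_vec d v) S + cl_mult d (cl_vec d v) (cl_vec d u) S
     = (\<Sum>i<d. \<Sum>j<d. u $ i * v $ j * (?e i j + ?e j i))"
    by (simp only: cl_mult_vec_vec sum.distrib distrib_left)
  also have "\<dots> = (\<Sum>i<d. \<Sum>j<d. if i = j then u $ i * v $ i * (- 2 * cl_one S) else 0)"
    unfolding e by (intro sum.cong) auto
  finally show ?thesis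
    by (simp add: sum_distrib_left sum_distrib_right sum_negf algebra_simps)
qed

section \<open>Orthogonal matrices and reflections\<close>

text \<open>Here \<open>Matrix.unit_vec n j\<close> is the j-th standard basis vector, whereas
  unqualified \<open>unit_vec\<close> is the predicate of having norm 1.\<close>

lemma mat_eqI_mult_vec:
  fixes A B :: "'a::semiring_1 mat"
  assumes A: "A \<in> carrier_mat m n" and B: "B \<in> carrier_mat m n"
    and eq: "\<And>j. j < n \<Longrightarrow> A *\<^sub>v Matrix.unit_vec n j = B *\<^sub>v Matrix.unit_vec n j"
  shows "A = B"
proof (rule eq_matI)
  fix i j assume ij: "i < dim_row B" "j < dim_col B"
  have "(A *\<^sub>v Matrix.unit_vec n j) $ i = A $$ (i, j)" "(B *\<^sub>v Matrix.unit_vec n j) $ i = B $$ (i, j)"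
    using A B ij by auto
  then show "A $$ (i, j) = B $$ (i, j)"
    using eq[of j] B ij by auto
qed (use A B in auto)

lemma unit_vec_iff: "unit_vec d u \<longleftrightarrow> u \<in> carrier_vec d \<and> u \<bullet> u = 1"
  by (auto simp: unit_vec_def scalar_prod_def power2_eq_square atLeast0LessThan)

lemma orth_mat_right_inverse: "orth_mat d A \<Longrightarrow> A * transpose_mat A = 1\<^sub>m d"
  unfolding orth_mat_def by (metis mat_mult_left_right_inverse transpose_carrier_mat)

lemma orth_mat_mult:
  assumes "orth_mat d A" "orth_mat d B"
  shows "orth_mat d (A * B)"
proof -
  have A: "A \<in> carrier_mat d d" "transpose_mat A * A = 1\<^sub>m d"
    and B: "B \<in> carrier_mat d d" "transpose_mat B * B = 1\<^sub>m d"
    using assms by (auto simp: orth_mat_def)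
  have "transpose_mat (A * B) * (A * B) = transpose_mat B * (transpose_mat A * (A * B))"
    using A B by (simp add: transpose_mult[of _ d d _ d] assoc_mult_mat[of _ d d _ d _ d])
  also have "transpose_mat A * (A * B) = B"
    using A B by (simp flip: assoc_mult_mat[of _ d d _ d _ d])
  finally show ?thesis
    using A B by (simp add: orth_mat_def)
qed

lemma orth_mat_scalar_prod:
  assumes "orth_mat d A" "v \<in> carrier_vec d" "w \<in> carrier_vec d"
  shows "(A *\<^sub>v v) \<bullet> (A *\<^sub>v w) = v \<bullet> w"
proof -
  have A: "A \<in> carrier_mat d d" "transpose_mat A * A = 1\<^sub>m d"
    using assms(1) by (auto simp: orth_mat_def)
  have "(A *\<^sub>v v) \<bullet> (A *\<^sub>v w) = (transpose_mat A *\<^sub>v (A *\<^sub>v v)) \<bullet> w"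
    using A assms by (intro transpose_vec_mult_scalar[symmetric]) auto
  also have "transpose_mat A *\<^sub>v (A *\<^sub>v v) = v"
    using A assms(2) by (simp flip: assoc_mult_mat_vec[of _ d d _ d])
  finally show ?thesis .
qed

text \<open>The Householder matrix \<open>1 - 2 u u\<^sup>T\<close>, which is the reflection in the
  hyperplane orthogonal to u when u has norm 1.\<close>

definition reflection :: "nat \<Rightarrow> real vec \<Rightarrow> real mat" where
  "reflection d u = mat d d (\<lambda>(i, j). (if i = j then 1 else 0) - 2 * u $ i * u $ j)"

lemma reflection_carrier [simp]: "reflection d u \<in> carrier_mat d d"
  by (simp add: reflection_def)

lemma reflection_mult_vec:
  assumes u: "u \<in> carrier_vec d" and v: "v \<in> carrier_vec d"
  shows "reflection d u *\<^sub>v v = v - (2 * (u \<bullet> v)) \<cdot>\<^sub>v u"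
proof (rule eq_vecI)
  fix i assume "i < dim_vec (v - (2 * (u \<bullet> v)) \<cdot>\<^sub>v u)"
  then have i: "i < d" using u by simp
  have "(reflection d u *\<^sub>v v) $ i = (\<Sum>j<d. ((if i = j then 1 else 0) - 2 * u $ i * u $ j) * v $ j)"
    using i v by (simp add: reflection_def scalar_prod_def atLeast0LessThan)
  also have "\<dots> = (\<Sum>j<d. (if i = j then v $ j else 0)) - 2 * u $ i * (\<Sum>j<d. u $ j * v $ j)"
  proof -
    have "((if i = j then 1 else 0) - 2 * u $ i * u $ j) * v $ j
       = (if i = j then v $ j else 0) - 2 * u $ i * (u $ j * v $ j)" for j
      by (simp add: left_diff_distrib)
    then show ?thesis by (simp only: sum_subtractf sum_distrib_left)
  qed
  finally show "(reflection d u *\<^sub>v v) $ i = (v - (2 * (u \<bullet> v)) \<cdot>\<^sub>v u) $ i"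
    using i u v by (simp add: scalar_prod_def atLeast0LessThan)
qed (use u v in \<open>auto simp: reflection_def\<close>)

lemma reflection_reflection:
  assumes "unit_vec d u"
  shows "reflection d u * reflection d u = 1\<^sub>m d"
proof (rule mat_eqI_mult_vec[of _ d d])
  fix j assume "j < d"
  let ?e = "Matrix.unit_vec d j :: real vec"
  have u: "u \<in> carrier_vec d" "u \<bullet> u = 1" using assms by (auto simp: unit_vec_iff)
  have e: "?e \<in> carrier_vec d" by simp
  have "u \<bullet> (?e - (2 * (u \<bullet> ?e)) \<cdot>\<^sub>v u) = - (u \<bullet> ?e)"
    using u e by (simp add: scalar_prod_minus_distrib[of _ d])
  then have "reflection d u *\<^sub>v (reflection d u *\<^sub>v ?e)
      = ?e - (2 * (u \<bullet> ?e)) \<cdot>\<^sub>v u - (2 * (- (u \<bullet> ?e))) \<cdot>\<^sub>v u"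
    using u e by (simp only: reflection_mult_vec[of _ d] minus_carrier_vec smult_carrier_vec)
  also have "\<dots> = ?e"
    using u by (intro eq_vecI) auto
  finally show "(reflection d u * reflection d u) *\<^sub>v ?e = 1\<^sub>m d *\<^sub>v ?e"
    by (simp add: assoc_mult_mat_vec[of _ d d _ d])
qed (auto intro: mult_carrier_mat[of _ d d])

lemma reflection_transpose [simp]: "transpose_mat (reflection d u) = reflection d u"
  by (rule eq_matI) (auto simp: reflection_def)

lemma reflection_orth: "unit_vec d u \<Longrightarrow> orth_mat d (reflection d u)"
  by (simp add: orth_mat_def reflection_reflection)

section \<open>The Pin group\<close>

lemma Pin_one [simp]: "cl_one \<in> Pin d"
  unfolding Pin_def by (auto intro: exI[of _ "[]"])

lemma Pin_vec_mult:
  assumes "unit_vec d u" "x \<in> Pin d"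
  shows "cl_mult d (cl_vec d u) x \<in> Pin d"
proof -
  obtain us where "x = foldr (cl_mult d) (map (cl_vec d) us) cl_one" "\<forall>u\<in>set us. unit_vec d u"
    using assms(2) by (auto simp: Pin_def)
  then show ?thesis
    using assms(1) unfolding Pin_def by (auto intro!: exI[of _ "u # us"])
qed

text \<open>Splits off the leftmost vector, so that a claim about Pin is checked only for left
  multiplication by one unit vector.\<close>

lemma Pin_induct [consumes 1, case_names one vec_mult]:
  assumes "x \<in> Pin d" "P cl_one"
    and "\<And>u x. unit_vec d u \<Longrightarrow> x \<in> Pin d \<Longrightarrow> P x \<Longrightarrow> P (cl_mult d (cl_vec d u) x)"
  shows "P x"
proof -
  obtain us where x: "x = foldr (cl_mult d) (map (cl_vec d) us) cl_one" and us: "\<forall>u\<in>set us. unit_vec d u"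
    using assms(1) by (auto simp: Pin_def)
  from us have "P (foldr (cl_mult d) (map (cl_vec d) us) cl_one)"
    using assms(2,3) by (induction us) (auto simp: Pin_def)
  then show ?thesis using x by simp
qed

lemma Pin_carrier: "x \<in> Pin d \<Longrightarrow> x \<in> cl_carrier d"
  by (induction rule: Pin_induct) auto

lemma Pin_vec: "unit_vec d u \<Longrightarrow> cl_vec d u \<in> Pin d"
  using Pin_vec_mult[of d u cl_one] by simp

lemma Pin_mult:
  assumes "x \<in> Pin d" "y \<in> Pin d"
  shows "cl_mult d x y \<in> Pin d"
  using assms by (induction rule: Pin_induct) (auto simp: cl_mult_assoc Pin_vec_mult Pin_carrier)

lemma unit_vec_square:
  assumes "unit_vec d u"
  shows "cl_mult d (cl_vec d u) (cl_vec d u) = cl_scale (-1) cl_one"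
proof
  fix S
  show "cl_mult d (cl_vec d u) (cl_vec d u) S = cl_scale (-1) cl_one S"
    using cl_vec_anticommute[of d u u S] assms
    by (simp only: unit_vec_def cl_scale_def power2_eq_square)
qed

lemma Pin_star:
  assumes "x \<in> Pin d"
  shows "cl_star x \<in> Pin d"
  using assms
proof (induction rule: Pin_induct)
  case (vec_mult u x)
  \<comment> \<open>\<open>cl_star\<close> sends the vector u to -u, again a unit vector, and
    reverses products.\<close>
  have "unit_vec d (- 1 \<cdot>\<^sub>v u)"
    using vec_mult(1) by (auto simp: unit_vec_iff)
  then have "cl_vec d (- 1 \<cdot>\<^sub>v u) \<in> Pin d"
    by (rule Pin_vec)
  then show ?case
    using vec_mult by (auto simp: cl_star_mult cl_star_vec cl_vec_scale unit_vec_def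
        simp del: cl_scale_simps intro!: Pin_mult)
qed simp

lemma Pin_star_mult:
  assumes "x \<in> Pin d"
  shows "cl_mult d (cl_star x) x = cl_one" "cl_mult d x (cl_star x) = cl_one"
proof -
  have "cl_mult d (cl_star x) x = cl_one \<and> cl_mult d x (cl_star x) = cl_one"
    using assms
  proof (induction rule: Pin_induct)
    case (vec_mult u x)
    let ?u = "cl_vec d u"
    have uu: "cl_mult d ?u (cl_mult d ?u y) = cl_scale (-1) y" if "y \<in> cl_carrier d" for y
      using unit_vec_square[OF vec_mult(1)] that by (simp flip: cl_mult_assoc)
    have "cl_mult d (cl_star (cl_mult d ?u x)) (cl_mult d ?u x) = cl_one"
      using vec_mult by (simp add: cl_star_mult cl_star_vec cl_mult_assoc uu Pin_carrier)
    moreover have "cl_mult d (cl_mult d ?u x) (cl_star (cl_mult d ?u x))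
       = cl_scale (-1) (cl_mult d ?u (cl_mult d (cl_mult d x (cl_star x)) ?u))"
      by (simp add: cl_star_mult cl_star_vec cl_mult_assoc)
    ultimately show ?case
      using vec_mult by (simp add: unit_vec_square)
  qed simp
  then show "cl_mult d (cl_star x) x = cl_one" "cl_mult d x (cl_star x) = cl_one"
    by auto
qed

lemma Pin_cancel_left:
  assumes "x \<in> Pin d" "y \<in> cl_carrier d"
  shows "cl_mult d (cl_star x) (cl_mult d x y) = y" "cl_mult d x (cl_mult d (cl_star x) y) = y"
  using assms by (simp_all add: Pin_star_mult flip: cl_mult_assoc)

text \<open>A product of vectors is homogeneous, even or odd according to the number of
  factors.\<close>

lemma Pin_alpha:
  assumes "x \<in> Pin d"
  shows "cl_alpha x = x \<or> cl_alpha x = cl_scale (-1) x"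
  using assms by (induction rule: Pin_induct) (auto simp: cl_alpha_mult cl_alpha_vec)

section \<open>The double cover\<close>

text \<open>The graph of the double cover. As a relation it can be multiplied and inverted without
  first resolving the definite description in \<open>pin_rho\<close>; \<open>pin_rho_eq_iff\<close>
  links the two.\<close>

definition pin_covers :: "nat \<Rightarrow> cliff \<Rightarrow> real mat \<Rightarrow> bool" where
  "pin_covers d x A \<longleftrightarrow> x \<in> Pin d \<and> A \<in> carrier_mat d d \<and>
     (\<forall>v\<in>carrier_vec d. cl_mult d (cl_alpha x) (cl_vec d v) = cl_mult d (cl_vec d (A *\<^sub>v v)) x)"

lemma pin_covers_one: "pin_covers d cl_one (1\<^sub>m d)"
  by (auto simp: pin_covers_def)

lemma pin_covers_mult:
  assumes "pin_covers d x A" "pin_covers d y B"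
  shows "pin_covers d (cl_mult d x y) (A * B)"
  unfolding pin_covers_def
proof (intro conjI ballI)
  have A: "A \<in> carrier_mat d d" and B: "B \<in> carrier_mat d d"
    using assms by (auto simp: pin_covers_def)
  then show "A * B \<in> carrier_mat d d" by simp
  show "cl_mult d x y \<in> Pin d"
    using assms by (auto simp: pin_covers_def Pin_mult)
  fix v :: "real vec" assume v: "v \<in> carrier_vec d"
  have "cl_mult d (cl_alpha (cl_mult d x y)) (cl_vec d v)
      = cl_mult d (cl_alpha x) (cl_mult d (cl_vec d (B *\<^sub>v v)) y)"
    using assms(2) v by (simp add: cl_alpha_mult cl_mult_assoc pin_covers_def)
  also have "\<dots> = cl_mult d (cl_mult d (cl_vec d (A *\<^sub>v (B *\<^sub>v v))) x) y"
    using assms(1) B v by (simp add: pin_covers_def flip: cl_mult_assoc)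
  finally show "cl_mult d (cl_alpha (cl_mult d x y)) (cl_vec d v)
      = cl_mult d (cl_vec d (A * B *\<^sub>v v)) (cl_mult d x y)"
    using A B v by (simp add: cl_mult_assoc assoc_mult_mat_vec[of _ d d _ d])
qed

text \<open>Since \<open>u\<^sup>2 = -1\<close>, (v - 2(u, v)u)u = vu + 2(u, v) = -uv, and -uv is
  the twisted left side. The twist by \<open>cl_alpha\<close> is what yields the reflection rather
  than its negative.\<close>

lemma pin_covers_reflection:
  assumes "unit_vec d u"
  shows "pin_covers d (cl_vec d u) (reflection d u)"
  unfolding pin_covers_def
proof (intro conjI ballI)
  show "cl_vec d u \<in> Pin d" using assms by (rule Pin_vec)
  fix v :: "real vec" assume v: "v \<in> carrier_vec d"
  let ?u = "cl_vec d u" and ?v = "cl_vec d v"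
  have u: "u \<in> carrier_vec d" using assms by (simp add: unit_vec_def)
  have sp: "(\<Sum>i<d. u $ i * v $ i) = u \<bullet> v"
    using v by (simp add: scalar_prod_def atLeast0LessThan)
  have minus_mult: "cl_mult d (\<lambda>S. x S - y S) z S = cl_mult d x z S - cl_mult d y z S" for x y z S
    by (simp add: cl_mult_left_sum left_diff_distrib right_diff_distrib sum_subtractf)
  have "cl_vec d (reflection d u *\<^sub>v v) = (\<lambda>S. ?v S - cl_scale (2 * (u \<bullet> v)) ?u S)"
    using u v by (auto simp: reflection_mult_vec cl_vec_minus cl_vec_scale)
  then have "cl_mult d (cl_vec d (reflection d u *\<^sub>v v)) ?u S
      = cl_mult d ?v ?u S + 2 * (u \<bullet> v) * cl_one S" for S
    using unit_vec_square[OF assms] by (simp add: minus_mult cl_scale_def[of _ _ S])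
  then have "cl_mult d (cl_vec d (reflection d u *\<^sub>v v)) ?u S = - cl_mult d ?u ?v S" for S
    using cl_vec_anticommute[of d u v S] sp by simp
  then show "cl_mult d (cl_alpha ?u) ?v = cl_mult d (cl_vec d (reflection d u *\<^sub>v v)) ?u"
    by (auto simp: cl_alpha_vec cl_scale_def)
qed simp

lemma pin_covers_unique:
  assumes "pin_covers d x A" "pin_covers d x B"
  shows "A = B"
proof (rule mat_eqI_mult_vec[of _ d d])
  fix j assume "j < d"
  let ?e = "Matrix.unit_vec d j :: real vec"
  have x: "x \<in> Pin d" using assms by (simp add: pin_covers_def)
  have "cl_mult d (cl_vec d (A *\<^sub>v ?e)) x = cl_mult d (cl_vec d (B *\<^sub>v ?e)) x"
    using assms by (simp add: pin_covers_def)
  then have "cl_mult d (cl_vec d (A *\<^sub>v ?e)) (cl_mult d x (cl_star x))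
      = cl_mult d (cl_vec d (B *\<^sub>v ?e)) (cl_mult d x (cl_star x))"
    by (simp flip: cl_mult_assoc)
  then have "cl_vec d (A *\<^sub>v ?e) = cl_vec d (B *\<^sub>v ?e)"
    by (simp add: Pin_star_mult[OF x])
  then show "A *\<^sub>v ?e = B *\<^sub>v ?e"
    using assms by (intro cl_vec_inj[of d]) (auto simp: pin_covers_def)
qed (use assms in \<open>auto simp: pin_covers_def\<close>)

lemma Pin_covers_some:
  assumes "x \<in> Pin d"
  shows "\<exists>A. pin_covers d x A"
  using assms
  by (induction rule: Pin_induct) (blast intro: pin_covers_one pin_covers_mult pin_covers_reflection)+

lemma pin_rho_eq_iff:
  assumes "x \<in> Pin d"
  shows "pin_rho d x = A \<longleftrightarrow> pin_covers d x A"
proof -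
  obtain B where B: "pin_covers d x B" using Pin_covers_some assms by blast
  have "pin_rho d x = (THE A. pin_covers d x A)"
    using assms by (simp add: pin_rho_def pin_covers_def)
  also have "\<dots> = B"
    using B pin_covers_unique by blast
  finally show ?thesis
    using B pin_covers_unique by blast
qed

lemma pin_covers_star:
  assumes "pin_covers d x A" "orth_mat d A"
  shows "pin_covers d (cl_star x) (transpose_mat A)"
  unfolding pin_covers_def
proof (intro conjI ballI)
  have x: "x \<in> Pin d" and A: "A \<in> carrier_mat d d"
    using assms by (auto simp: pin_covers_def)
  show "cl_star x \<in> Pin d" using x by (rule Pin_star)
  show "transpose_mat A \<in> carrier_mat d d" using A by simp
  fix v :: "real vec" assume v: "v \<in> carrier_vec d"
  define w where "w = transpose_mat A *\<^sub>v v"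
  have w: "w \<in> carrier_vec d" using A v by (simp add: w_def)
  have "A *\<^sub>v w = v"
    using A v orth_mat_right_inverse[OF assms(2)] by (simp add: w_def flip: assoc_mult_mat_vec[of _ d d _ d])
  then have "cl_mult d (cl_alpha x) (cl_vec d w) = cl_mult d (cl_vec d v) x"
    using assms(1) w by (simp add: pin_covers_def)
  then have "cl_mult d (cl_alpha (cl_star x)) (cl_mult d (cl_mult d (cl_alpha x) (cl_vec d w)) (cl_star x))
    = cl_mult d (cl_alpha (cl_star x)) (cl_mult d (cl_mult d (cl_vec d v) x) (cl_star x))"
    by simp
  then have "cl_mult d (cl_alpha (cl_mult d (cl_star x) x)) (cl_mult d (cl_vec d w) (cl_star x))
    = cl_mult d (cl_alpha (cl_star x)) (cl_mult d (cl_vec d v) (cl_mult d x (cl_star x)))"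
    by (simp add: cl_alpha_mult cl_mult_assoc)
  then show "cl_mult d (cl_alpha (cl_star x)) (cl_vec d v) = cl_mult d (cl_vec d (transpose_mat A *\<^sub>v v)) (cl_star x)"
    by (simp add: Pin_star_mult[OF x] flip: w_def)
qed

text \<open>Comparing the coefficients of \<open>e\<^bsub>S - {i}\<^esub>\<close> for \<open>i \<in> S\<close> in \<open>\<alpha>(x) e\<^sub>i = e\<^sub>i x\<close>.\<close>
lemma twisted_central_imp_scalar:
  assumes car: "x \<in> cl_carrier d"
    and eq: "\<And>v. v \<in> carrier_vec d \<Longrightarrow> cl_mult d (cl_alpha x) (cl_vec d v) = cl_mult d (cl_vec d v) x"
  shows "x = cl_scale (x {}) cl_one"
proof
  fix S
  show "x S = cl_scale (x {}) cl_one S"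
  proof (cases "S \<subseteq> {..<d} \<and> S \<noteq> {}")
    case True
    then obtain i where i: "i \<in> S" "i < d" by blast
    have fin: "finite S" using True finite_subset by blast
    let ?T = "sym_diff {i} S" and ?v = "Matrix.unit_vec d i :: real vec"
    have T: "?T \<subseteq> {..<d}" using True i by auto
    have vec: "cl_vec d ?v B = (if B = {i} then 1 else 0)" for B
      using i by (auto simp: cl_vec_def split: if_splits)
    have S: "sym_diff {i} ?T = S" by blast
    have "cl_mult d (cl_alpha x) (cl_vec d ?v) ?T
        = (\<Sum>B\<in>Pow {..<d}. if B = {i} then cl_sign S {i} * cl_alpha x S else 0)"
      unfolding cl_mult_right_sum if_P[OF T] vec using S by (intro sum.cong) (auto simp: S)
    then have l: "cl_mult d (cl_alpha x) (cl_vec d ?v) ?T = cl_sign S {i} * cl_alpha x S"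
      using i by simp
    have "cl_mult d (cl_vec d ?v) x ?T
        = (\<Sum>B\<in>Pow {..<d}. if B = {i} then cl_sign {i} S * x S else 0)"
      unfolding cl_mult_left_sum if_P[OF T] vec using S by (intro sum.cong) (auto simp: S)
    then have r: "cl_mult d (cl_vec d ?v) x ?T = cl_sign {i} S * x S"
      using i by simp
    \<comment> \<open>One factor has a sign for each j \<ge> i in S, the other for each j \<le> i,
      so i is counted twice and every other element once.\<close>
    have "cl_sign S {i} * cl_sign {i} S = (\<Prod>j\<in>S. if j = i then 1 else -1)"
      using fin by (auto simp: cl_sign_prod simp flip: prod.distrib intro!: prod.cong)
    also have "\<dots> = (\<Prod>j\<in>S - {i}. -1)"
      using fin i by (simp add: prod.remove[of S i])
    also have "\<dots> = - ((-1) ^ card S)"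
      unfolding card.remove[OF fin i(1)] by simp
    finally have sgn: "cl_sign S {i} * cl_sign {i} S = - ((-1) ^ card S)" .
    have "cl_sign S {i} * ((-1) ^ card S * x S) = cl_sign {i} S * x S"
      unfolding cl_alpha_def[symmetric] by (metis l r eq Matrix.unit_vec_carrier)
    then have "cl_sign {i} S * (cl_sign S {i} * ((-1) ^ card S * x S)) = cl_sign {i} S * (cl_sign {i} S * x S)"
      by simp
    then have "(cl_sign S {i} * cl_sign {i} S) * (-1) ^ card S * x S = (cl_sign {i} S * cl_sign {i} S) * x S"
      by (simp only: mult.assoc mult.commute mult.left_commute)
    then have "- x S = x S"
      unfolding sgn cl_sign_square by (metis minus_one_mult_self mult.left_neutral mult_minus_left)
    then show ?thesis using True by (simp add: cl_scale_def cl_one_def)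
  next
    case False
    then show ?thesis using car by (auto simp: cl_carrier_def cl_scale_def cl_one_def)
  qed
qed

text \<open>An element over the identity is a scalar c by the preceding lemma. Scalars are fixed by
  \<open>cl_star\<close>, which inverts elements of Pin, so \<open>c * c = 1\<close>.\<close>

lemma pin_covers_one_imp:
  assumes "pin_covers d x (1\<^sub>m d)"
  shows "x = cl_one \<or> x = cl_scale (-1) cl_one"
proof -
  have x: "x \<in> Pin d" using assms by (simp add: pin_covers_def)
  have "x = cl_scale (x {}) cl_one"
    using assms by (intro twisted_central_imp_scalar[of _ d]) (auto simp: pin_covers_def Pin_carrier)
  then obtain c where c: "x = cl_scale c cl_one" ..
  have "cl_star x = x"
    unfolding c by (auto simp: cl_star_def cl_scale_def cl_one_def)
  then have "cl_mult d x x = cl_one" using Pin_star_mult(1)[OF x] by simp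
  then have "cl_scale (c * c) cl_one = cl_scale 1 cl_one" by (simp add: c)
  then have "cl_scale (c * c) cl_one {} = cl_scale 1 cl_one {}" by simp
  then have "c * c = 1" by (simp add: cl_scale_def cl_one_def)
  then have "c = 1 \<or> c = -1" using square_eq_1_iff by blast
  then show ?thesis using c by auto
qed

lemma pin_covers_eq:
  assumes "pin_covers d x A" "pin_covers d y A" "orth_mat d A"
  shows "y = x \<or> y = cl_scale (-1) x"
proof -
  have x: "x \<in> Pin d" and y: "y \<in> Pin d" using assms by (auto simp: pin_covers_def)
  have "pin_covers d (cl_mult d y (cl_star x)) (1\<^sub>m d)"
    using pin_covers_mult[OF assms(2) pin_covers_star[OF assms(1,3)]] orth_mat_right_inverse[OF assms(3)]
    by simp
  then have "cl_mult d y (cl_star x) = cl_one \<or> cl_mult d y (cl_star x) = cl_scale (-1) cl_one"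
    by (rule pin_covers_one_imp)
  moreover have "y = cl_mult d (cl_mult d y (cl_star x)) x"
    using x y by (simp add: cl_mult_assoc Pin_star_mult Pin_carrier)
  ultimately show ?thesis
    using x by (auto simp: Pin_carrier)
qed

section \<open>Surjectivity of the double cover by Householder reflections\<close>

lemma scalar_prod_self_pos:
  fixes w :: "real vec"
  assumes "w \<in> carrier_vec d" "w \<noteq> 0\<^sub>v d"
  shows "w \<bullet> w > 0"
proof -
  have "w \<bullet> w \<ge> 0"
    by (auto simp: scalar_prod_def intro: sum_nonneg)
  moreover have "w \<bullet> w \<noteq> 0"
  proof
    assume "w \<bullet> w = 0"
    then have "\<forall>i\<in>{0..<dim_vec w}. w $ i * w $ i = 0"
      unfolding scalar_prod_def by (subst (asm) sum_nonneg_eq_0_iff) auto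
    then have "w = 0\<^sub>v d" using assms(1) by (intro eq_vecI) auto
    then show False using assms(2) by simp
  qed
  ultimately show ?thesis by simp
qed

lemma exists_unit_direction:
  fixes w :: "real vec"
  assumes w: "w \<in> carrier_vec d" "w \<noteq> 0\<^sub>v d"
  obtains c where "unit_vec d (c \<cdot>\<^sub>v w)" "c * c * (w \<bullet> w) = 1"
proof
  have pos: "w \<bullet> w > 0" using w by (rule scalar_prod_self_pos)
  define c where "c = 1 / sqrt (w \<bullet> w)"
  show c: "c * c * (w \<bullet> w) = 1" using pos by (simp add: c_def)
  show "unit_vec d (c \<cdot>\<^sub>v w)" using w c by (simp add: unit_vec_iff mult.assoc)
qed

text \<open>If A fixes the basis vectors below k and moves \<open>e\<^sub>k\<close>, the reflection
  along \<open>A e\<^sub>k - e\<^sub>k\<close> returns \<open>A e\<^sub>k\<close> to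
  \<open>e\<^sub>k\<close> without disturbing the earlier ones. The induction runs from k = d, where
  A is the identity, down to k = 0.\<close>

theorem cartan_dieudonne:
  assumes "orth_mat d A"
  shows "\<exists>x. pin_covers d x A"
proof -
  let ?e = "Matrix.unit_vec d :: nat \<Rightarrow> real vec"
  have "\<exists>x. pin_covers d x A" if "k \<le> d" "orth_mat d A" "\<And>j. j < k \<Longrightarrow> A *\<^sub>v ?e j = ?e j" for k A
    using that
  proof (induction k arbitrary: A rule: inc_induct)
    case base
    then have "A = 1\<^sub>m d"
      by (intro mat_eqI_mult_vec[of _ d d]) (auto simp: orth_mat_def)
    then show ?case using pin_covers_one by blast
  next
    case (step k)
    have k: "k < d" using step by simp
    have A: "A \<in> carrier_mat d d" using step by (simp add: orth_mat_def)
    define a where "a = A *\<^sub>v ?e k"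
    define w where "w = a - ?e k"
    have e: "?e j \<in> carrier_vec d" for j by simp
    have a: "a \<in> carrier_vec d" using A by (simp add: a_def)
    have w: "w \<in> carrier_vec d" using a by (simp add: w_def)
    show ?case
    proof (cases "w = 0\<^sub>v d")
      case True
      have "a = ?e k"
      proof (rule eq_vecI)
        fix i assume "i < dim_vec (?e k)"
        then have "i < d" by simp
        then have "w $ i = 0" using True by simp
        then show "a $ i = ?e k $ i" using \<open>i < d\<close> by (simp add: w_def)
      qed (use a in simp)
      then show ?thesis
        using step by (intro step.IH) (auto simp: a_def less_Suc_eq)
    next
      case False
      obtain c where u: "unit_vec d (c \<cdot>\<^sub>v w)" and c: "c * c * (w \<bullet> w) = 1"
        using exists_unit_direction[OF w False] .
      define R where "R = reflection d (c \<cdot>\<^sub>v w)"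
      have R: "R *\<^sub>v v = v - (2 * (c * c * (w \<bullet> v))) \<cdot>\<^sub>v w" if "v \<in> carrier_vec d" for v
        using w that by (simp add: R_def reflection_mult_vec smult_smult_assoc algebra_simps)
      have Rc: "R \<in> carrier_mat d d" by (simp add: R_def)
      have aa: "a \<bullet> a = 1"
        using orth_mat_scalar_prod[OF step.prems(1) e e, of k k] k by (simp add: a_def)
      \<comment> \<open>Because \<open>a\<close> and \<open>e\<^sub>k\<close> have equal norm. It
        turns the reflection formula at \<open>a\<close> into a - w.\<close>
      have "w \<bullet> w = 2 * (w \<bullet> a)"
        using a k aa comm_scalar_prod[OF a e[of k]]
        by (simp add: w_def minus_scalar_prod_distrib[of _ d] scalar_prod_minus_distrib[of _ d])
      then have "2 * (c * c * (w \<bullet> a)) = 1" using c by (simp add: algebra_simps)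
      then have Ra: "R *\<^sub>v a = ?e k"
        using R[OF a] a w by (auto simp: w_def)
      \<comment> \<open>A preserves inner products and fixes \<open>e\<^sub>j\<close>, so both parts
        of w are orthogonal to it.\<close>
      have we: "w \<bullet> ?e j = 0" if "j < k" for j
      proof -
        have "a \<bullet> ?e j = ?e k \<bullet> ?e j"
          using orth_mat_scalar_prod[OF step.prems(1) e e, of k j] step.prems(2)[OF that]
          by (simp add: a_def)
        then show ?thesis using a that k
          by (simp add: w_def minus_scalar_prod_distrib[of _ d])
      qed
      have "\<exists>y. pin_covers d y (R * A)"
      proof (rule step.IH)
        show "orth_mat d (R * A)"
          unfolding R_def using step.prems(1) u by (intro orth_mat_mult reflection_orth)
        fix j assume "j < Suc k"
        then consider "j < k" | "j = k" by linarith
        then show "R * A *\<^sub>v ?e j = ?e j"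
        proof cases
          case 1
          then show ?thesis using A Rc step.prems(2)[OF 1] we[OF 1] R[OF e[of j]] w
            by (auto simp: assoc_mult_mat_vec[of _ d d _ d] intro!: eq_vecI)
        next
          case 2
          then show ?thesis using A Rc Ra by (simp add: assoc_mult_mat_vec[of _ d d _ d] a_def)
        qed
      qed
      then obtain y where y: "pin_covers d y (R * A)" ..
      have "R * (R * A) = A"
        using A Rc reflection_reflection[OF u] by (simp add: R_def flip: assoc_mult_mat[of _ d d _ d _ d])
      then show ?thesis
        using pin_covers_mult[OF pin_covers_reflection[OF u] y] by (auto simp: R_def)
    qed
  qed
  from this[of 0] show ?thesis using assms by simp
qed

section \<open>Lifts of orthogonal involutions and their squares\<close>

lemma mat_trace_orth_le:
  assumes "orth_mat d A"
  shows "mat_trace A \<le> real d"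
proof -
  let ?e = "Matrix.unit_vec d :: nat \<Rightarrow> real vec"
  have A: "A \<in> carrier_mat d d" using assms by (simp add: orth_mat_def)
  have "A $$ (i, i) \<le> 1" if "i < d" for i
  proof -
    \<comment> \<open>Columns of an orthogonal matrix have norm 1, which bounds each diagonal
      entry.\<close>
    have "(A *\<^sub>v ?e i) \<bullet> (A *\<^sub>v ?e i) = 1"
      using orth_mat_scalar_prod[OF assms, of "?e i" "?e i"] that by simp
    then have "(\<Sum>k<d. A $$ (k, i) * A $$ (k, i)) = 1"
      using A that by (simp add: scalar_prod_def[of "A *\<^sub>v ?e i"] atLeast0LessThan)
    moreover have "A $$ (i, i) * A $$ (i, i) \<le> (\<Sum>k<d. A $$ (k, i) * A $$ (k, i))"
      using that by (intro member_le_sum) auto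
    ultimately have "(A $$ (i, i))\<^sup>2 \<le> 1" by (simp add: power2_eq_square)
    then show ?thesis by (metis abs_square_le_1 abs_le_D1)
  qed
  then have "(\<Sum>i<d. A $$ (i, i)) \<le> (\<Sum>i<d. 1)"
    by (intro sum_mono) auto
  then show ?thesis using A by (simp add: mat_trace_def)
qed

text \<open>Splitting off one \<open>-1\<close>-eigenvector at a time writes \<open>x\<close> as a product of \<open>h\<close>
  orthonormal vectors, where \<open>h\<close> is the multiplicity of the eigenvalue \<open>-1\<close>.\<close>
lemma involution_cover:
  assumes "orth_mat d T" "T * T = 1\<^sub>m d"
  obtains h x where "pin_covers d x T" "real d - mat_trace T = 2 * real h"
    "cl_alpha x = cl_scale ((-1) ^ h) x" "cl_mult d x x = cl_scale ((-1) ^ (\<Sum>{0..h})) cl_one"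
proof -
  \<comment> \<open>The defect d - tr T is a real number not yet known to be an even integer, so the
    induction is on a natural number N exceeding it; N = 0 is impossible by the trace bound.\<close>
  have "\<exists>h x. pin_covers d x T \<and> real d - mat_trace T = 2 * real h \<and>
      cl_alpha x = cl_scale ((-1) ^ h) x \<and> cl_mult d x x = cl_scale ((-1) ^ (\<Sum>{0..h})) cl_one"
    if "real d - mat_trace T < real N" "orth_mat d T" "T * T = 1\<^sub>m d" for N T
    using that
  proof (induction N arbitrary: T)
    case 0
    then show ?case using mat_trace_orth_le[of d T] by simp
  next
    case (Suc N)
    have T: "T \<in> carrier_mat d d" using Suc.prems(2) by (simp add: orth_mat_def)
    show ?case
    proof (cases "T = 1\<^sub>m d")
      case True
      have "mat_trace T = real d" by (simp add: True mat_trace_def)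
      then show ?thesis
        using pin_covers_one[of d] True by (intro exI[of _ 0] exI[of _ cl_one]) simp
    next
      case False
      have "\<exists>j<d. T *\<^sub>v Matrix.unit_vec d j \<noteq> Matrix.unit_vec d j"
      proof (rule ccontr)
        assume "\<not> ?thesis"
        then have "T = 1\<^sub>m d" using T by (intro mat_eqI_mult_vec[of _ d d]) auto
        then show False using False by simp
      qed
      then obtain e where e: "e \<in> carrier_vec d" "T *\<^sub>v e \<noteq> e"
        using Matrix.unit_vec_carrier by blast
      \<comment> \<open>Applying T exchanges the two terms, so w is an eigenvector for -1.\<close>
      define w where "w = T *\<^sub>v e - e"
      have w: "w \<in> carrier_vec d" using T e by (simp add: w_def)
      have w0: "w \<noteq> 0\<^sub>v d"
      proof
        assume "w = 0\<^sub>v d"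
        have "T *\<^sub>v e = e"
        proof (rule eq_vecI)
          fix i assume "i < dim_vec e"
          then have "w $ i = 0" using \<open>w = 0\<^sub>v d\<close> e by simp
          then show "(T *\<^sub>v e) $ i = e $ i" using \<open>i < dim_vec e\<close> by (simp add: w_def)
        qed (use T e in simp)
        then show False using e by simp
      qed
      have TT: "T *\<^sub>v (T *\<^sub>v v) = v" if "v \<in> carrier_vec d" for v
        using T that Suc.prems(3) by (simp flip: assoc_mult_mat_vec[of _ d d _ d])
      have Tw: "T *\<^sub>v w = - 1 \<cdot>\<^sub>v w"
      proof -
        have "T *\<^sub>v w = T *\<^sub>v (T *\<^sub>v e) - T *\<^sub>v e"
          unfolding w_def using T e by (intro mult_minus_distrib_mat_vec[of _ d d]) auto
        then show ?thesis using T e by (auto simp: TT w_def intro!: eq_vecI)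
      qed
      obtain c where u: "unit_vec d (c \<cdot>\<^sub>v w)" using exists_unit_direction[OF w w0] .
      define u where "u = c \<cdot>\<^sub>v w"
      note u = u[folded u_def]
      have uc: "u \<in> carrier_vec d" "u \<bullet> u = 1" using u by (auto simp: unit_vec_iff)
      have Tu: "T *\<^sub>v u = - 1 \<cdot>\<^sub>v u"
        using T w Tw by (auto simp: u_def mult_mat_vec[of _ d d] intro!: eq_vecI)
      have uT: "u \<bullet> (T *\<^sub>v v) = - (u \<bullet> v)" if "v \<in> carrier_vec d" for v
      proof -
        have "u \<bullet> (T *\<^sub>v v) = (T *\<^sub>v u) \<bullet> (T *\<^sub>v (T *\<^sub>v v))"
          using T that uc by (intro orth_mat_scalar_prod[OF Suc.prems(2), symmetric]) auto
        then show ?thesis using that uc by (simp add: TT Tu)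
      qed
      define R where "R = reflection d u"
      have Rc: "R \<in> carrier_mat d d" by (simp add: R_def)
      have RTv: "R *\<^sub>v (T *\<^sub>v v) = T *\<^sub>v v + (2 * (u \<bullet> v)) \<cdot>\<^sub>v u" if "v \<in> carrier_vec d" for v
        using T uc that by (auto simp: R_def reflection_mult_vec uT intro!: eq_vecI)
      \<comment> \<open>The reflection along an eigenvector of the orthogonal T commutes with T, so
        \<open>R * T\<close> is again an involution.\<close>
      have "R * T = T * R"
      proof (rule mat_eqI_mult_vec[of _ d d])
        fix j assume "j < d"
        let ?v = "Matrix.unit_vec d j :: real vec"
        have v: "?v \<in> carrier_vec d" by simp
        have "T *\<^sub>v (R *\<^sub>v ?v) = T *\<^sub>v ?v - T *\<^sub>v ((2 * (u \<bullet> ?v)) \<cdot>\<^sub>v u)"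
          unfolding R_def reflection_mult_vec[OF uc(1) v]
          using T uc by (intro mult_minus_distrib_mat_vec[of _ d d]) auto
        also have "\<dots> = R *\<^sub>v (T *\<^sub>v ?v)"
          using T uc v by (auto simp: RTv[OF v] mult_mat_vec[of _ d d] Tu intro!: eq_vecI)
        finally show "(R * T) *\<^sub>v ?v = (T * R) *\<^sub>v ?v"
          using T Rc by (simp add: assoc_mult_mat_vec[of _ d d _ d])
      qed (use T Rc in auto)
      then have "(R * T) * (R * T) = (R * T) * (T * R)" by simp
      also have "\<dots> = R * (T * T) * R"
        using T Rc by (simp add: assoc_mult_mat[of _ d d _ d _ d])
      finally have sq: "(R * T) * (R * T) = 1\<^sub>m d"
        using Suc.prems(3) reflection_reflection[OF u] by (simp add: R_def right_mult_one_mat[OF reflection_carrier])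
      \<comment> \<open>Summed over i this raises the trace by 2, as u has norm 1: one eigenvalue -1
        has become 1.\<close>
      have "(R * T) $$ (i, i) = T $$ (i, i) + 2 * (u $ i * u $ i)" if "i < d" for i
      proof -
        let ?v = "Matrix.unit_vec d i :: real vec"
        have "M $$ (i, i) = (M *\<^sub>v ?v) $ i" if "M \<in> carrier_mat d d" for M :: "real mat"
          using \<open>i < d\<close> that by auto
        from this[of "R * T"] this[of T]
        have "(R * T) $$ (i, i) = ((R * T) *\<^sub>v ?v) $ i" "T $$ (i, i) = (T *\<^sub>v ?v) $ i"
          using T Rc by auto
        moreover have "(R * T) *\<^sub>v ?v = R *\<^sub>v (T *\<^sub>v ?v)"
          using T Rc by (simp add: assoc_mult_mat_vec[of _ d d _ d])
        moreover have "(R *\<^sub>v (T *\<^sub>v ?v)) $ i = (T *\<^sub>v ?v) $ i + 2 * (u $ i * u $ i)"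
          unfolding RTv[OF Matrix.unit_vec_carrier] using T uc that by simp
        ultimately show ?thesis
          by (simp only:)
      qed
      then have "(\<Sum>i<d. (R * T) $$ (i, i)) = (\<Sum>i<d. T $$ (i, i) + 2 * (u $ i * u $ i))"
        by (intro sum.cong) auto
      moreover have "dim_row (R * T) = d" "dim_row T = d" using T Rc by auto
      ultimately have "mat_trace (R * T) = mat_trace T + 2 * (\<Sum>i<d. u $ i * u $ i)"
        unfolding mat_trace_def by (simp only: sum.distrib sum_distrib_left)
      then have tr: "mat_trace (R * T) = mat_trace T + 2"
        using uc by (simp add: scalar_prod_def atLeast0LessThan)
      have "real d - mat_trace (R * T) < real N"
        using Suc.prems(1) tr by simp
      moreover have "orth_mat d (R * T)"
        unfolding R_def using Suc.prems(2) u by (intro orth_mat_mult reflection_orth)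
      ultimately obtain h y where y: "pin_covers d y (R * T)" "real d - mat_trace (R * T) = 2 * real h"
        "cl_alpha y = cl_scale ((-1) ^ h) y" "cl_mult d y y = cl_scale ((-1) ^ (\<Sum>{0..h})) cl_one"
        using Suc.IH sq by blast
      let ?u = "cl_vec d u"
      have "R * (R * T) = T"
        using T Rc reflection_reflection[OF u] by (simp add: R_def flip: assoc_mult_mat[of _ d d _ d _ d])
      then have "pin_covers d (cl_mult d ?u y) T"
        using pin_covers_mult[OF pin_covers_reflection[OF u] y(1)] by (simp add: R_def)
      moreover have "real d - mat_trace T = 2 * real (Suc h)"
        using y(2) tr by simp
      moreover have "cl_alpha (cl_mult d ?u y) = cl_scale ((-1) ^ Suc h) (cl_mult d ?u y)"
        by (simp add: cl_alpha_mult cl_alpha_vec y)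
      moreover have "cl_mult d (cl_mult d ?u y) (cl_mult d ?u y) = cl_scale ((-1) ^ (\<Sum>{0..Suc h})) cl_one"
      proof -
        \<comment> \<open>As \<open>R * T\<close> fixes u, its lift y satisfies
          \<open>yu = (-1)\<^sup>h uy\<close>. Hence
          \<open>(uy)\<^sup>2 = (-1)\<^sup>h u\<^sup>2 y\<^sup>2\<close>, which adds
          \<open>Suc h\<close> to the exponent.\<close>
        have "(R * T) *\<^sub>v u = T *\<^sub>v u + (2 * (u \<bullet> u)) \<cdot>\<^sub>v u"
          unfolding RTv[OF uc(1), symmetric] by (rule assoc_mult_mat_vec[OF Rc T uc(1)])
        also have "\<dots> = u"
          using uc by (auto simp: Tu intro!: eq_vecI)
        finally have "(R * T) *\<^sub>v u = u" .
        then have "cl_mult d (cl_alpha y) ?u = cl_mult d ?u y"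
          using y(1) uc by (simp add: pin_covers_def)
        then have "cl_scale ((-1) ^ h) (cl_scale ((-1) ^ h) (cl_mult d y ?u)) = cl_scale ((-1) ^ h) (cl_mult d ?u y)"
          unfolding y(3) by simp
        then have yu: "cl_mult d y ?u = cl_scale ((-1) ^ h) (cl_mult d ?u y)"
          by (simp flip: power_mult_distrib)
        have "cl_mult d (cl_mult d ?u y) (cl_mult d ?u y) = cl_mult d ?u (cl_mult d (cl_mult d y ?u) y)"
          by (simp add: cl_mult_assoc)
        also have "\<dots> = cl_scale ((-1) ^ h) (cl_mult d (cl_mult d ?u ?u) (cl_mult d y y))"
          by (simp add: yu cl_mult_assoc)
        also have "\<dots> = cl_scale ((-1) ^ (\<Sum>{0..Suc h})) cl_one"
          by (simp add: unit_vec_square[OF u] y(4) power_add mult.commute)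
        finally show ?thesis .
      qed
      ultimately show ?thesis by blast
    qed
  qed
  moreover obtain N where "real d - mat_trace T < real N"
    using reals_Archimedean2 by blast
  ultimately show ?thesis using assms that by blast
qed

section \<open>Generators and relations for the alternating group\<close>

text \<open>The 3-cycle \<open>1 \<mapsto> 2 \<mapsto> i \<mapsto> 1\<close>.\<close>
definition cyc12 :: "nat \<Rightarrow> nat \<Rightarrow> nat" where
  "cyc12 i = transpose 1 2 \<circ> transpose 2 i"

lemma cyc12_apply:
  assumes "i \<ge> 3"
  shows "cyc12 i 1 = 2" "cyc12 i 2 = i" "cyc12 i i = 1" "j \<notin> {1, 2, i} \<Longrightarrow> cyc12 i j = j"
  using assms by (auto simp: cyc12_def transpose_def)

lemma cyc12_cube: "i \<ge> 3 \<Longrightarrow> cyc12 i (cyc12 i (cyc12 i j)) = j"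
  by (auto simp: cyc12_def transpose_def)

lemma cyc12_permutes: "3 \<le> i \<Longrightarrow> i \<le> n \<Longrightarrow> cyc12 i permutes {1..n}"
  unfolding cyc12_def by (intro permutes_compose permutes_swap_id) auto

lemma cyc12_in_alt_group:
  assumes "3 \<le> i" "i \<le> n"
  shows "cyc12 i \<in> carrier (alt_group n)"
  using assms cyc12_permutes[OF assms]
  by (simp add: alt_group_carrier) (simp add: cyc12_def evenperm_comp permutation_swap_id evenperm_swap)

text \<open>Positive words in \<open>X 3\<close>, ..., \<open>X k\<close>. Generators of order 3
  make positive words suffice, and the bound k mirrors the chain of alternating groups on 1, ...,
  k.\<close>

inductive_set words :: "('a, 'm) monoid_scheme \<Rightarrow> (nat \<Rightarrow> 'a) \<Rightarrow> nat \<Rightarrow> 'a set"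
  for G :: "('a, 'm) monoid_scheme" and X :: "nat \<Rightarrow> 'a" and k :: nat where
  one: "\<one>\<^bsub>G\<^esub> \<in> words G X k"
| step: "w \<in> words G X k \<Longrightarrow> 3 \<le> i \<Longrightarrow> i \<le> k \<Longrightarrow> w \<otimes>\<^bsub>G\<^esub> X i \<in> words G X k"

lemma words_mono:
  assumes "w \<in> words G X k" "k \<le> l"
  shows "w \<in> words G X l"
  using assms by (induction rule: words.induct) (auto intro: words.intros)

lemma words_trivial:
  assumes "w \<in> words G X k" "k \<le> 2"
  shows "w = \<one>\<^bsub>G\<^esub>"
  using assms by (induction rule: words.induct) auto

context monoid
begin

lemma words_carrier:
  assumes "w \<in> words G X k" "\<And>i. 3 \<le> i \<Longrightarrow> i \<le> k \<Longrightarrow> X i \<in> carrier G"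
  shows "w \<in> carrier G"
  using assms by (induction rule: words.induct) auto

lemma words_gen:
  assumes "3 \<le> i" "i \<le> k" "X i \<in> carrier G"
  shows "X i \<in> words G X k"
  using words.step[OF words.one assms(1,2), of G X] assms(3) by simp

lemma words_mult:
  assumes w: "w \<in> words G X k" and v: "v \<in> words G X k"
    and X: "\<And>i. 3 \<le> i \<Longrightarrow> i \<le> k \<Longrightarrow> X i \<in> carrier G"
  shows "w \<otimes> v \<in> words G X k"
  using v
proof (induction rule: words.induct)
  case one
  then show ?case using words_carrier[OF w X] w by simp
next
  case (step v i)
  then have "w \<otimes> (v \<otimes> X i) = w \<otimes> v \<otimes> X i"
    using words_carrier[OF w X] words_carrier[OF step(1) X] X by (simp add: m_assoc)
  then show ?case using step by (auto intro: words.step)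
qed

text \<open>The hypotheses are the relations of the tetrahedral group, the alternating group on four
  points. The conclusions are rewriting rules for a = \<open>X k\<close> and b = \<open>X i\<close>
  with i < k: they bring powers of b to the left and leave a coset representative on the
  right.\<close>

lemma tetrahedral_relations:
  assumes a: "a \<in> carrier G" "a \<otimes> a \<otimes> a = \<one>" and b: "b \<in> carrier G" "b \<otimes> b \<otimes> b = \<one>"
    and ab: "(a \<otimes> b) \<otimes> (a \<otimes> b) = \<one>" and ba: "(b \<otimes> a) \<otimes> (b \<otimes> a) = \<one>"
  shows "a \<otimes> b = b \<otimes> b \<otimes> (a \<otimes> a)"
    and "a \<otimes> a \<otimes> b \<otimes> b = b \<otimes> a"
    and "a \<otimes> a \<otimes> b \<otimes> a = b \<otimes> b \<otimes> (a \<otimes> a \<otimes> b)"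
    and "a \<otimes> b \<otimes> b = b \<otimes> b \<otimes> (a \<otimes> a \<otimes> b)"
proof -
  note [simp] = a(1) b(1)
  have a3: "a \<otimes> (a \<otimes> a) = \<one>" "\<And>x. x \<in> carrier G \<Longrightarrow> a \<otimes> (a \<otimes> (a \<otimes> x)) = x"
    using a by (simp_all flip: m_assoc)
  have b3: "b \<otimes> (b \<otimes> b) = \<one>" "\<And>x. x \<in> carrier G \<Longrightarrow> b \<otimes> (b \<otimes> (b \<otimes> x)) = x"
    using b by (simp_all flip: m_assoc)
  have "a \<otimes> b = ((a \<otimes> b) \<otimes> (a \<otimes> b)) \<otimes> (b \<otimes> b \<otimes> (a \<otimes> a))"
    by (simp add: m_assoc a3 b3)
  then show 1: "a \<otimes> b = b \<otimes> b \<otimes> (a \<otimes> a)"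
    unfolding ab by simp
  have "b \<otimes> a = ((b \<otimes> a) \<otimes> (b \<otimes> a)) \<otimes> (a \<otimes> a \<otimes> b \<otimes> b)"
    by (simp add: m_assoc a3 b3)
  then show 2: "a \<otimes> a \<otimes> b \<otimes> b = b \<otimes> a"
    unfolding ba by simp
  have "b \<otimes> a \<otimes> b = ((b \<otimes> a) \<otimes> (b \<otimes> a)) \<otimes> (a \<otimes> a)"
    by (simp add: m_assoc a3)
  then have bab: "a \<otimes> a = b \<otimes> a \<otimes> b"
    unfolding ba by simp
  \<comment> \<open>Replacing both outer squares by bab produces a cube of b in the middle, which
    vanishes.\<close>
  have "a \<otimes> a \<otimes> b \<otimes> (a \<otimes> a) = (b \<otimes> a \<otimes> b) \<otimes> b \<otimes> (b \<otimes> a \<otimes> b)"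
    unfolding bab ..
  also have "\<dots> = b \<otimes> (a \<otimes> a) \<otimes> b"
    by (simp add: m_assoc b3)
  finally have conj: "a \<otimes> a \<otimes> b \<otimes> (a \<otimes> a) = b \<otimes> (a \<otimes> a) \<otimes> b" .
  have "a \<otimes> a \<otimes> b \<otimes> a = (a \<otimes> a \<otimes> b \<otimes> (a \<otimes> a)) \<otimes> (a \<otimes> a)"
    by (simp add: m_assoc a3)
  also have "\<dots> = b \<otimes> (a \<otimes> a) \<otimes> b \<otimes> (a \<otimes> a)"
    by (simp only: conj)
  also have "\<dots> = b \<otimes> (a \<otimes> a \<otimes> b \<otimes> (a \<otimes> a))"
    by (simp add: m_assoc)
  also have "\<dots> = b \<otimes> b \<otimes> (a \<otimes> a \<otimes> b)"
    unfolding conj by (simp add: m_assoc)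
  finally show 3: "a \<otimes> a \<otimes> b \<otimes> a = b \<otimes> b \<otimes> (a \<otimes> a \<otimes> b)" .
  have "a \<otimes> b \<otimes> b = a \<otimes> a \<otimes> (a \<otimes> a \<otimes> b \<otimes> b)"
    by (simp add: m_assoc a3)
  also have "\<dots> = a \<otimes> a \<otimes> b \<otimes> a"
    unfolding 2 by (simp add: m_assoc)
  finally show "a \<otimes> b \<otimes> b = b \<otimes> b \<otimes> (a \<otimes> a \<otimes> b)"
    using 3 by simp
qed

end

text \<open>The relations of Moore's presentation of the alternating group.\<close>
locale alt_relations = monoid G for G (structure) +
  fixes X :: "nat \<Rightarrow> 'a" and n :: nat
  assumes X_closed: "3 \<le> i \<Longrightarrow> i \<le> n \<Longrightarrow> X i \<in> carrier G"
    and X_cube: "3 \<le> i \<Longrightarrow> i \<le> n \<Longrightarrow> X i \<otimes> X i \<otimes> X i = \<one>"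
    and X_pair: "3 \<le> i \<Longrightarrow> i \<le> n \<Longrightarrow> 3 \<le> j \<Longrightarrow> j \<le> n \<Longrightarrow> i \<noteq> j \<Longrightarrow>
      (X i \<otimes> X j) \<otimes> (X i \<otimes> X j) = \<one>"
begin

text \<open>Over permutations these represent the k right cosets of the stabiliser of the point k; a
  coset is told by the point sent to k, which is k, 2, 1 and i in the order listed.\<close>

definition coset_reps :: "nat \<Rightarrow> 'a set" where
  "coset_reps k = {\<one>, X k, X k \<otimes> X k} \<union> {X k \<otimes> X k \<otimes> X i | i. 3 \<le> i \<and> i < k}"

text \<open>The coset table: right multiplication by any generator leads from a representative to a
  representative, up to a word s in the lower generators on the left.\<close>

lemma coset_reps_step:
  assumes m: "2 \<le> m" "Suc m \<le> n" and r: "r \<in> coset_reps (Suc m)" and j: "3 \<le> j" "j \<le> Suc m"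
  shows "\<exists>s\<in>words G X m. \<exists>r'\<in>coset_reps (Suc m). r \<otimes> X j = s \<otimes> r'"
proof -
  let ?a = "X (Suc m)"
  have a: "?a \<in> carrier G" "?a \<otimes> ?a \<otimes> ?a = \<one>"
    using X_closed[of "Suc m"] X_cube[of "Suc m"] m by auto
  have X: "X i \<in> carrier G" if "3 \<le> i" "i \<le> m" for i
    using X_closed[of i] that m by simp
  note rel = tetrahedral_relations[OF a X X_cube X_pair X_pair]
  have gen: "X i \<in> words G X m" if "3 \<le> i" "i \<le> m" for i
    using that by (intro words_gen X)
  note one = words.one[of G X m]
  have reps: "\<one> \<in> coset_reps (Suc m)" "?a \<in> coset_reps (Suc m)" "?a \<otimes> ?a \<in> coset_reps (Suc m)"
    "\<And>i. 3 \<le> i \<Longrightarrow> i \<le> m \<Longrightarrow> ?a \<otimes> ?a \<otimes> X i \<in> coset_reps (Suc m)"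
    by (auto simp: coset_reps_def)
  have gen2: "X i \<otimes> X i \<in> words G X m" if "3 \<le> i" "i \<le> m" for i
    using that by (intro words_mult gen X) auto
  consider "r = \<one>" | "r = ?a" | "r = ?a \<otimes> ?a" | i where "3 \<le> i" "i \<le> m" "r = ?a \<otimes> ?a \<otimes> X i"
    using r by (auto simp: coset_reps_def)
  then show ?thesis
  proof cases
    case 1
    show ?thesis
    proof (cases "j = Suc m")
      case True
      then show ?thesis using 1 one reps a by (intro bexI[of _ \<one>] bexI[of _ ?a]) auto
    next
      case False
      then have "X j \<in> words G X m" "X j \<in> carrier G" using gen X j by auto
      then show ?thesis using 1 reps by (intro bexI[of _ "X j"] bexI[of _ \<one>]) auto
    qed
  next
    case 2
    show ?thesis
    proof (cases "j = Suc m")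
      case True
      then show ?thesis using 2 one reps a by (intro bexI[of _ \<one>] bexI[of _ "?a \<otimes> ?a"]) auto
    next
      case False
      then have "?a \<otimes> X j = X j \<otimes> X j \<otimes> (?a \<otimes> ?a)" using j m by (intro rel(1)) auto
      then show ?thesis using 2 reps gen2[of j] False j
        by (intro bexI[of _ "X j \<otimes> X j"] bexI[of _ "?a \<otimes> ?a"]) auto
    qed
  next
    case 3
    show ?thesis
    proof (cases "j = Suc m")
      case True
      then show ?thesis using 3 one reps a by (intro bexI[of _ \<one>] bexI[of _ \<one>]) auto
    next
      case False
      then show ?thesis using 3 one reps(4)[of j] X[of j] a j
        by (intro bexI[of _ \<one>] bexI[of _ "?a \<otimes> ?a \<otimes> X j"]) auto
    qed
  next
    case (4 i)
    consider "j = Suc m" | "j = i" | "j \<noteq> i" "j \<le> m" using j by linarith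
    then show ?thesis
    proof cases
      case 1
      then have "r \<otimes> X j = X i \<otimes> X i \<otimes> (?a \<otimes> ?a \<otimes> X i)"
        unfolding 4 using 4 m by (simp only:) (intro rel(3); simp)
      then show ?thesis using reps(4) gen2 4 by blast
    next
      case 2
      then have "r \<otimes> X j = X i \<otimes> ?a"
        unfolding 4 using 4 m by (simp only:) (intro rel(2); simp)
      then show ?thesis using reps(2) gen 4 by blast
    next
      case 3
      have ij: "X i \<in> carrier G" "X j \<in> carrier G" using X 4 3 j by auto
      \<comment> \<open>The only entry involving three generators. Reversing the lower pair lets
        \<open>?a\<close> meet first \<open>X j\<close> and then \<open>X i\<close>, each time
        inside a two-generator relation.\<close>
      have "X i \<otimes> X j = X j \<otimes> X j \<otimes> (X i \<otimes> X i)"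
        using 3 4 m j by (intro tetrahedral_relations X_closed X_cube X_pair) auto
      then have "r \<otimes> X j = ?a \<otimes> ?a \<otimes> (X j \<otimes> X j \<otimes> (X i \<otimes> X i))"
        using 4 ij a by (simp add: m_assoc)
      also have "\<dots> = (?a \<otimes> ?a \<otimes> X j \<otimes> X j) \<otimes> (X i \<otimes> X i)"
        using ij a(1) by (simp add: m_assoc)
      also have "?a \<otimes> ?a \<otimes> X j \<otimes> X j = X j \<otimes> ?a"
        using 3 m j by (intro rel(2)) auto
      also have "X j \<otimes> ?a \<otimes> (X i \<otimes> X i) = X j \<otimes> (?a \<otimes> X i \<otimes> X i)"
        using ij a(1) by (simp add: m_assoc)
      also have "?a \<otimes> X i \<otimes> X i = X i \<otimes> X i \<otimes> (?a \<otimes> ?a \<otimes> X i)"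
        using 4 m by (intro rel(4)) auto
      also have "X j \<otimes> \<dots> = X j \<otimes> (X i \<otimes> X i) \<otimes> (?a \<otimes> ?a \<otimes> X i)"
        using ij a(1) by (simp add: m_assoc)
      finally have "r \<otimes> X j = X j \<otimes> (X i \<otimes> X i) \<otimes> (?a \<otimes> ?a \<otimes> X i)" .
      moreover have "X j \<otimes> (X i \<otimes> X i) \<in> words G X m"
        using 3 4 j by (intro words_mult gen gen2 X) auto
      ultimately show ?thesis using reps(4) 4 by blast
    qed
  qed
qed

lemma words_coset_decomposition:
  assumes w: "w \<in> words G X (Suc m)" and m: "2 \<le> m" "Suc m \<le> n"
  shows "\<exists>h\<in>words G X m. \<exists>r\<in>coset_reps (Suc m). w = h \<otimes> r"
  using w
proof (induction rule: words.induct)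
  case one
  then show ?case
    by (intro bexI[of _ \<one>] words.one) (auto simp: coset_reps_def)
next
  case (step w i)
  have X: "3 \<le> i \<Longrightarrow> i \<le> Suc m \<Longrightarrow> X i \<in> carrier G" for i
    using X_closed m by auto
  have reps: "r \<in> carrier G" if "r \<in> coset_reps (Suc m)" for r
    using that m X X_closed[of "Suc m"] by (auto simp: coset_reps_def)
  obtain h r where h: "h \<in> words G X m" and r: "r \<in> coset_reps (Suc m)" and w: "w = h \<otimes> r"
    using step.IH by blast
  obtain s r' where s: "s \<in> words G X m" and r': "r' \<in> coset_reps (Suc m)" and eq: "r \<otimes> X i = s \<otimes> r'"
    using coset_reps_step[OF m r step.hyps(2,3)] by blast
  have "h \<in> carrier G" "s \<in> carrier G"
    using h s X by (auto intro: words_carrier)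
  then have "w \<otimes> X i = (h \<otimes> s) \<otimes> r'"
    using reps[OF r] reps[OF r'] X[OF step.hyps(2,3)] eq w by (simp add: m_assoc)
  moreover have "h \<otimes> s \<in> words G X m"
    using h s X by (intro words_mult) auto
  ultimately show ?case using r' by blast
qed

end

text \<open>Abstracts the projection of the pullback onto permutations; on words it turns out to be
  bijective.\<close>

locale alt_cover = alt_relations G X n for G (structure) and X n +
  fixes \<phi> :: "'a \<Rightarrow> nat \<Rightarrow> nat"
  assumes \<phi>_mult: "x \<in> carrier G \<Longrightarrow> y \<in> carrier G \<Longrightarrow> \<phi> (x \<otimes> y) = \<phi> x \<circ> \<phi> y"
    and \<phi>_one: "\<phi> \<one> = id"
    and \<phi>_X: "3 \<le> i \<Longrightarrow> i \<le> n \<Longrightarrow> \<phi> (X i) = cyc12 i"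
begin

lemma \<phi>_permutes:
  assumes "w \<in> words G X k" "k \<le> n"
  shows "\<phi> w permutes {1..k}"
  using assms
proof (induction rule: words.induct)
  case one
  then show ?case using permutes_id \<phi>_one by metis
next
  case (step w i)
  have "w \<in> carrier G" "X i \<in> carrier G"
    using step X_closed by (auto intro: words_carrier)
  then have "\<phi> (w \<otimes> X i) = \<phi> w \<circ> cyc12 i"
    using step by (simp only: \<phi>_mult \<phi>_X)
  moreover have "\<phi> w \<circ> cyc12 i permutes {1..k}"
    using step by (intro permutes_compose cyc12_permutes) auto
  ultimately show ?case by (simp only:)
qed

text \<open>A word over the identity must represent the trivial coset of the words in one generator
  less, because the other representatives move the point \<open>k\<close>.\<close>
lemma \<phi>_kernel:
  assumes "w \<in> words G X k" "k \<le> n" "\<phi> w = id"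
  shows "w = \<one>"
  using assms
proof (induction k arbitrary: w)
  case 0
  then show ?case by (auto intro: words_trivial)
next
  case (Suc m)
  show ?case
  proof (cases "m < 2")
    case True
    then show ?thesis using Suc.prems(1) by (auto intro: words_trivial)
  next
    case False
    then have m: "2 \<le> m" "Suc m \<le> n" using Suc.prems by auto
    obtain h r where h: "h \<in> words G X m" and r: "r \<in> coset_reps (Suc m)" and w: "w = h \<otimes> r"
      using words_coset_decomposition[OF Suc.prems(1) m] by blast
    have X: "3 \<le> i \<Longrightarrow> i \<le> Suc m \<Longrightarrow> X i \<in> carrier G" for i
      using X_closed m by auto
    have hc: "h \<in> carrier G" using h X by (auto intro: words_carrier)
    have rc: "r \<in> carrier G" using r m X X_closed[of "Suc m"] by (auto simp: coset_reps_def)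
    have hp: "\<phi> h permutes {1..m}" using \<phi>_permutes[OF h] m by simp
    have "\<phi> h (\<phi> r (Suc m)) = Suc m"
      using Suc.prems(3) hc rc by (simp add: w \<phi>_mult fun_eq_iff)
    moreover have "\<phi> h (Suc m) = Suc m"
      using permutes_not_in[OF hp] by simp
    ultimately have fix_r: "\<phi> r (Suc m) = Suc m"
      using permutes_inj[OF hp] by (metis injD)
    have a: "X (Suc m) \<in> carrier G" "\<phi> (X (Suc m)) = cyc12 (Suc m)"
      using X \<phi>_X m by auto
    have c: "cyc12 (Suc m) 1 = 2" "cyc12 (Suc m) (Suc m) = 1"
      using cyc12_apply[of "Suc m"] m by auto
    have "r = \<one>"
    proof (rule ccontr)
      assume "r \<noteq> \<one>"
      then consider "r = X (Suc m)" | "r = X (Suc m) \<otimes> X (Suc m)"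
        | i where "3 \<le> i" "i \<le> m" "r = X (Suc m) \<otimes> X (Suc m) \<otimes> X i"
        using r by (auto simp: coset_reps_def)
      then show False
      proof cases
        case 3
        \<comment> \<open>So r sends \<open>Suc m\<close> to 1 and then to 2, contradicting
          \<open>fix_r\<close>.\<close>
        have "cyc12 i (Suc m) = Suc m" using 3 m by (intro cyc12_apply(4)) auto
        moreover have "\<phi> r = cyc12 (Suc m) \<circ> cyc12 (Suc m) \<circ> cyc12 i"
          using 3 a X[of i] m by (simp add: \<phi>_mult \<phi>_X)
        ultimately show False using fix_r c m by simp
      qed (use fix_r a c m in \<open>auto simp: \<phi>_mult\<close>)
    qed
    then have "w = h" using w hc by simp
    then show ?thesis using Suc.IH[OF h] Suc.prems by simp
  qed
qed

lemma words_lift: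
  assumes "g \<in> words (alt_group n) cyc12 n"
  shows "\<exists>w\<in>words G X n. \<phi> w = g"
  using assms
proof (induction rule: words.induct)
  case one
  then show ?case by (auto simp: alt_group_one \<phi>_one intro!: bexI[of _ \<one>] words.one)
next
  case (step g i)
  then obtain w where w: "w \<in> words G X n" "\<phi> w = g" by blast
  then have "w \<in> carrier G" using X_closed by (auto intro: words_carrier)
  then have "\<phi> (w \<otimes> X i) = g \<circ> cyc12 i"
    using step X_closed w by (simp add: \<phi>_mult \<phi>_X)
  then show ?case
    using w(1) step.hyps by (intro bexI[of _ "w \<otimes> X i"] words.step) (simp_all only: alt_group_mult)
qed

end

section \<open>Generation of the alternating group by the 3-cycles (1 2 i)\<close>

lemma alt_group_monoid: "monoid (alt_group n)"
  using alt_group_is_group by (rule group.is_monoid)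

text \<open>Sifting: left multiplication by 3-cycles moves the image of the largest point k back to
  k, after which the permutation lives on fewer points. The cycles used are undone by their
  squares.\<close>

lemma even_permutes_words:
  assumes "p permutes {1..k}" "evenperm p" "k \<le> n"
  shows "p \<in> words (alt_group n) cyc12 k"
  using assms
proof (induction k arbitrary: p)
  case 0
  then have "p = \<one>\<^bsub>alt_group n\<^esub>" by (simp add: alt_group_one)
  then show ?case using words.one by metis
next
  case (Suc m)
  interpret monoid "alt_group n" by (rule alt_group_monoid)
  note alt = alt_group_mult alt_group_one
  have id: "id \<in> words (alt_group n) cyc12 k" for k
    using words.one[of "alt_group n"] by (simp add: alt)
  show ?case
  proof (cases "m < 2")
    case True
    then consider "m = 0" | "m = 1" by linarith
    then have "p = id"
    proof cases
      case 1
      then show ?thesis using Suc.prems permutes_sing by simp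
    next
      case 2
      have "{1..Suc m} = {1, 2}" using 2 by auto
      then have "p = id \<or> p = transpose 1 2" using Suc.prems(1) permutes_doubleton_iff by metis
      then show ?thesis using Suc.prems(2) by (auto simp: evenperm_swap)
    qed
    then show ?thesis by (simp only: id)
  next
    case False
    let ?m = "Suc m"
    have m: "3 \<le> ?m" "?m \<le> n" using False Suc.prems by auto
    have cl: "cyc12 i \<in> carrier (alt_group n)" if "3 \<le> i" "i \<le> ?m" for i
      using cyc12_in_alt_group that m by simp
    have gen: "cyc12 i \<in> words (alt_group n) cyc12 ?m" if "3 \<le> i" "i \<le> ?m" for i
      using that cl by (intro words_gen) auto
    have comp: "w \<circ> v \<in> words (alt_group n) cyc12 ?m"
      if "w \<in> words (alt_group n) cyc12 ?m" "v \<in> words (alt_group n) cyc12 ?m" for w v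
      using words_mult[OF that cl] by (simp add: alt)
    have fixed: "q \<in> words (alt_group n) cyc12 ?m"
      if "q permutes {1..?m}" "evenperm q" "q ?m = ?m" for q
    proof -
      have "q permutes {1..m}"
      proof (rule permutes_superset[OF that(1)])
        fix x assume "x \<in> {1..?m} - {1..m}"
        then have "x = ?m" by auto
        then show "q x = x" using that(3) by (simp only:)
      qed
      then show ?thesis
        using Suc.IH[of q] that m by (auto intro: words_mono)
    qed
    have step: "q \<in> words (alt_group n) cyc12 ?m"
      if "cyc12 i \<circ> q \<in> words (alt_group n) cyc12 ?m" "3 \<le> i" "i \<le> ?m" for q i
    proof -
      have "cyc12 i \<circ> (cyc12 i \<circ> (cyc12 i \<circ> q)) = q"
        using cyc12_cube that(2) by (auto simp: fun_eq_iff)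
      moreover have "cyc12 i \<circ> (cyc12 i \<circ> (cyc12 i \<circ> q)) \<in> words (alt_group n) cyc12 ?m"
        using comp[OF gen[OF that(2,3)] comp[OF gen[OF that(2,3)] that(1)]] .
      ultimately show ?thesis by (simp only:)
    qed
    have ev: "cyc12 i \<circ> q permutes {1..?m} \<and> evenperm (cyc12 i \<circ> q)"
      if "q permutes {1..?m} \<and> evenperm q" "3 \<le> i" "i \<le> ?m" for q i
    proof -
      have "cyc12 i \<in> carrier (alt_group ?m)" "q \<in> carrier (alt_group ?m)"
        using that cyc12_in_alt_group by (auto simp: alt_group_carrier)
      then have "cyc12 i \<circ> q \<in> carrier (alt_group ?m)"
        using monoid.m_closed[OF alt_group_monoid, of _ ?m] by (simp add: alt)
      then show ?thesis by (simp add: alt_group_carrier)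
    qed
    have p: "p permutes {1..?m} \<and> evenperm p" using Suc.prems by simp
    have range: "p ?m \<in> {1..?m}" using permutes_in_image[OF Suc.prems(1)] by simp
    \<comment> \<open>The image travels i to 1 by \<open>cyc12 i\<close>, then 1 to 2 and 2 to
      \<open>?m\<close> by \<open>cyc12 ?m\<close>; the cases are treated from the end of this
      route.\<close>
    have in2: "q \<in> words (alt_group n) cyc12 ?m" if "q permutes {1..?m} \<and> evenperm q" "q ?m = 2" for q
      using that m ev[OF that(1), of ?m] cyc12_apply[of ?m]
      by (intro step[of ?m q] fixed) auto
    have in1: "q \<in> words (alt_group n) cyc12 ?m" if "q permutes {1..?m} \<and> evenperm q" "q ?m = 1" for q
      using that m ev[OF that(1), of ?m] cyc12_apply[of ?m]
      by (intro step[of ?m q] in2) auto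
    consider "p ?m = ?m" | "p ?m = 1" | "p ?m = 2" | "3 \<le> p ?m" "p ?m < ?m"
      using range by fastforce
    then show ?thesis
    proof cases
      case 1
      then show ?thesis using p fixed by blast
    next
      case 2
      then show ?thesis using p in1 by blast
    next
      case 3
      then show ?thesis using p in2 by blast
    next
      case 4
      then show ?thesis using ev[OF p, of "p ?m"] cyc12_apply(3)[of "p ?m"]
        by (intro step[of "p ?m" p] in1) auto
    qed
  qed
qed

lemma alt_group_words: "g \<in> carrier (alt_group n) \<Longrightarrow> g \<in> words (alt_group n) cyc12 n"
  by (simp add: alt_group_carrier even_permutes_words)

section \<open>Splitting the projection onto the alternating group\<close>

context alt_cover
begin

theorem alt_group_splitting:
  obtains f where "\<And>g. g \<in> carrier (alt_group n) \<Longrightarrow> f g \<in> carrier G \<and> \<phi> (f g) = g"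
    "\<And>g h. g \<in> carrier (alt_group n) \<Longrightarrow> h \<in> carrier (alt_group n) \<Longrightarrow> f (g \<circ> h) = f g \<otimes> f h"
proof -
  let ?W = "words G X n" and ?A = "carrier (alt_group n)"
  have carr: "w \<in> carrier G" if "w \<in> ?W" for w
    using that X_closed by (auto intro: words_carrier)
  have mult: "w \<otimes> v \<in> ?W" if "w \<in> ?W" "v \<in> ?W" for w v
    using that X_closed by (auto intro: words_mult)
  have ex: "\<exists>w\<in>?W. \<phi> w = g" if "g \<in> ?A" for g
    using words_lift alt_group_words[OF that] by blast
  \<comment> \<open>A monoid has no inverse to divide by, so a word u over the inverse permutation
    takes its place: both vu and uw lie over the identity, hence equal 1.\<close>
  have unique: "v = w" if vw: "v \<in> ?W" "w \<in> ?W" "\<phi> v = \<phi> w" and g: "\<phi> v \<in> ?A" for v w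
  proof -
    have "inv' (\<phi> v) \<in> ?A" using g by (rule alt_group_inv_closed)
    then obtain u where u: "u \<in> ?W" "\<phi> u = inv' (\<phi> v)" using ex by blast
    have "\<phi> v permutes {1..n}" using \<phi>_permutes[OF vw(1)] by simp
    note inv = permutes_inv_o[OF this]
    have "\<phi> (u \<otimes> w) = id" "\<phi> (v \<otimes> u) = id"
      using u vw(1,2) carr inv by (simp_all only: \<phi>_mult flip: vw(3))
    then have "u \<otimes> w = \<one>" "v \<otimes> u = \<one>"
      using u vw mult by (auto intro: \<phi>_kernel[of _ n])
    then have "v \<otimes> (u \<otimes> w) = v" "v \<otimes> u \<otimes> w = w" using carr vw by auto
    then show ?thesis using carr u vw by (simp add: m_assoc)
  qed
  obtain f where f: "\<And>g. g \<in> ?A \<Longrightarrow> f g \<in> ?W \<and> \<phi> (f g) = g"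
    using ex by metis
  show ?thesis
  proof (rule that)
    show "f g \<in> carrier G \<and> \<phi> (f g) = g" if "g \<in> ?A" for g
      using f[OF that] carr by auto
    show "f (g \<circ> h) = f g \<otimes> f h" if "g \<in> ?A" "h \<in> ?A" for g h
    proof -
      have "g \<circ> h \<in> ?A"
        using monoid.m_closed[OF alt_group_monoid that] by (simp add: alt_group_mult)
      then show ?thesis
        using f that mult carr by (intro unique) (auto simp: \<phi>_mult)
    qed
  qed
qed

end

section \<open>Lifting representations of the alternating group\<close>

text \<open>A transposition after p corrects the image of the new point; injectivity of p and
  distinctness of the targets keep it off the images already fixed.\<close>

lemma exists_permutes_map:
  assumes "length xs = length ys" "distinct xs" "distinct ys" "set xs \<subseteq> S" "set ys \<subseteq> S"
  shows "\<exists>p. p permutes S \<and> map p xs = ys"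
  using assms
proof (induction xs ys rule: list_induct2)
  case Nil
  then show ?case by (intro exI[of _ id] conjI permutes_id) simp
next
  case (Cons x xs y ys)
  then obtain p where p: "p permutes S" "map p xs = ys" by auto
  let ?q = "transpose (p x) y \<circ> p"
  have "p x \<in> S" using permutes_in_image[OF p(1)] Cons.prems by auto
  then have q: "?q permutes S"
    using Cons.prems by (intro permutes_compose p permutes_swap_id) auto
  have "?q z = p z" if "z \<in> set xs" for z
  proof -
    have "p z \<in> set ys" using p(2) that by auto
    then have "p z \<noteq> y" using Cons.prems by auto
    moreover have "p z \<noteq> p x" using permutes_inj[OF p(1)] that Cons.prems by (auto dest: injD)
    ultimately show ?thesis by simp
  qed
  then have "map ?q xs = ys"
    unfolding p(2)[symmetric] by (intro map_cong refl)
  then have "map ?q (x # xs) = y # ys"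
    by (simp only: list.map comp_apply transpose_apply_first)
  with q show ?case by (intro exI[of _ ?q] conjI)
qed

lemma s1s3_in_alt_group: "n \<ge> 4 \<Longrightarrow> s1s3 \<in> carrier (alt_group n)"
  by (simp add: alt_group_carrier s1s3_def evenperm_comp permutation_swap_id evenperm_swap
      permutes_compose permutes_swap_id)

lemma cyc12_comp_cyc12:
  assumes "3 \<le> i" "3 \<le> j" "i \<noteq> j"
  shows "cyc12 i \<circ> cyc12 j = transpose 1 i \<circ> transpose 2 j"
proof
  fix x
  show "(cyc12 i \<circ> cyc12 j) x = (transpose 1 i \<circ> transpose 2 j) x"
    using assms by (auto simp: cyc12_def transpose_def)
qed

text \<open>Equal cycle type gives a conjugating permutation. If it is odd, composing it with (1 2),
  which commutes with \<open>s1s3\<close>, makes it even.\<close>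

lemma cyc12_comp_cyc12_conj:
  assumes n: "n \<ge> 4" and i: "3 \<le> i" "i \<le> n" and j: "3 \<le> j" "j \<le> n" and "i \<noteq> j"
  obtains u where "u \<in> carrier (alt_group n)" "(cyc12 i \<circ> cyc12 j) \<circ> u = u \<circ> s1s3"
proof -
  let ?g = "transpose 1 i \<circ> transpose 2 j"
  \<comment> \<open>The cycles (1 2)(3 4) are relabelled as (1 i)(2 j).\<close>
  obtain u where u: "u permutes {1..n}" "map u [1, 2, 3, 4] = [1, i, 2, j]"
    using exists_permutes_map[of "[1, 2, 3, 4]" "[1, i, 2, j]" "{1..n}"] assms by auto
  have conj: "?g \<circ> u = u \<circ> s1s3"
  proof
    fix x
    have ux: "u 1 = 1" "u 2 = i" "u 3 = 2" "u 4 = j" using u(2) by simp_all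
    have other: "u x \<notin> {1, i, 2, j}" if "x \<notin> {1, 2, 3, 4}"
    proof -
      have "u x \<noteq> u y" if "y \<in> {1, 2, 3, 4}" for y
        using \<open>x \<notin> _\<close> that permutes_inj[OF u(1)] by (metis injD)
      from this[of 1] this[of 2] this[of 3] this[of 4] show ?thesis unfolding ux by simp
    qed
    have g: "?g 1 = i" "?g i = 1" "?g 2 = j" "?g j = 2" "\<And>y. y \<notin> {1, i, 2, j} \<Longrightarrow> ?g y = y"
      using assms by (simp_all add: transpose_def)
    have s: "s1s3 1 = 2" "s1s3 2 = 1" "s1s3 3 = 4" "s1s3 4 = 3"
      "\<And>y. y \<notin> {1, 2, 3, 4} \<Longrightarrow> s1s3 y = y"
      by (simp_all add: s1s3_def transpose_def)
    consider "x = 1" | "x = 2" | "x = 3" | "x = 4" | "x \<notin> {1, 2, 3, 4}" by blast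
    then show "(?g \<circ> u) x = (u \<circ> s1s3) x"
    proof cases
      case 5
      show ?thesis
        unfolding comp_apply[of ?g] comp_apply[of u] s(5)[OF 5] g(5)[OF other[OF 5]] ..
    qed (simp_all only: comp_apply[of ?g] comp_apply[of u] ux g s)
  qed
  have perm: "permutation u" using u(1) permutation_permutes by blast
  have t: "transpose 1 2 permutes {1..n}" using n by (intro permutes_swap_id) auto
  show ?thesis
  proof (cases "evenperm u")
    case True
    then show ?thesis
      using that[of u] conj u assms by (simp add: cyc12_comp_cyc12 alt_group_carrier)
  next
    case False
    have comm: "s1s3 \<circ> transpose 1 2 = transpose 1 2 \<circ> s1s3"
      by (auto simp: s1s3_def transpose_def fun_eq_iff)
    have "?g \<circ> (u \<circ> transpose 1 2) = u \<circ> s1s3 \<circ> transpose 1 2"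
      using conj by (simp only: o_assoc)
    also have "\<dots> = (u \<circ> transpose 1 2) \<circ> s1s3"
      using comm by (simp only: o_assoc[symmetric])
    finally have "?g \<circ> (u \<circ> transpose 1 2) = (u \<circ> transpose 1 2) \<circ> s1s3" .
    moreover have "evenperm (u \<circ> transpose 1 2)"
      using False perm by (simp only: evenperm_comp permutation_swap_id evenperm_swap) simp
    moreover have "u \<circ> transpose 1 2 permutes {1..n}"
      using u(1) t by (intro permutes_compose)
    ultimately show ?thesis
      using that[of "u \<circ> transpose 1 2"] assms by (simp only: cyc12_comp_cyc12 alt_group_carrier simp_thms)
  qed
qed

lemma Pin_scale_minus_one_neq:
  assumes "x \<in> Pin d"
  shows "cl_scale (-1) x \<noteq> x"
proof
  assume "cl_scale (-1) x = x"
  then have "cl_mult d (cl_scale (-1) x) (cl_star x) = cl_mult d x (cl_star x)" by simp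
  then have "cl_scale (-1) cl_one {} = cl_one {}"
    by (simp add: Pin_star_mult[OF assms])
  then show False by (simp add: cl_scale_def cl_one_def)
qed

lemma Pin_idempotent:
  assumes "x \<in> Pin d" "cl_mult d x x = x"
  shows "x = cl_one"
  using Pin_cancel_left(1)[OF assms(1) Pin_carrier[OF assms(1)]] assms Pin_star_mult(1) by simp

text \<open>For h = 2m the sum is m(2m + 1), of the parity of m. Evenness matters: h = 3 gives the
  even sum 6.\<close>

lemma even_sum_atMost_iff:
  assumes "even h"
  shows "even (\<Sum>{0..h}) \<longleftrightarrow> 4 dvd (h::nat)"
proof -
  obtain m where m: "h = 2 * m" using assms by blast
  have "\<Sum>{0..h} = m * (2 * m + 1)"
    unfolding gauss_sum_nat m by simp
  then show ?thesis using m by simp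
qed

section \<open>Lifts of single elements under a fixed representation\<close>

locale alt_rep =
  fixes n d :: nat and \<pi> :: "(nat \<Rightarrow> nat) \<Rightarrow> real mat"
  assumes n: "n \<ge> 4" and rep: "real_orth_rep (alt_group n) d \<pi>"
begin

abbreviation "A \<equiv> carrier (alt_group n)"

lemma A_comp: "g \<in> A \<Longrightarrow> h \<in> A \<Longrightarrow> g \<circ> h \<in> A"
  using monoid.m_closed[OF alt_group_monoid, of g n h] by (simp add: alt_group_mult)

lemma A_id: "id \<in> A"
  using monoid.one_closed[OF alt_group_monoid, of n] by (simp only: alt_group_one)

lemma rep_orth: "g \<in> A \<Longrightarrow> orth_mat d (\<pi> g)"
  using rep by (simp add: real_orth_rep_def)

lemma rep_comp: "g \<in> A \<Longrightarrow> h \<in> A \<Longrightarrow> \<pi> (g \<circ> h) = \<pi> g * \<pi> h"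
  using rep by (simp add: real_orth_rep_def alt_group_mult)

text \<open>\<open>real_orth_rep\<close> asks only for multiplicativity, but an orthogonal
  idempotent is the identity.\<close>

lemma rep_id: "\<pi> id = 1\<^sub>m d"
proof -
  let ?P = "\<pi> id"
  have P: "?P \<in> carrier_mat d d" "transpose_mat ?P * ?P = 1\<^sub>m d"
    using rep_orth[OF A_id] by (auto simp: orth_mat_def)
  have "?P = transpose_mat ?P * ?P * ?P" using P by simp
  also have "\<dots> = transpose_mat ?P * (?P * ?P)"
    using P by (intro assoc_mult_mat[of _ d d _ d _ d]) auto
  also have "?P * ?P = ?P" using rep_comp[OF A_id A_id] by simp
  finally have "?P = transpose_mat ?P * ?P" .
  then show ?thesis using P(2) by (rule trans)
qed

abbreviation "covers y g \<equiv> pin_covers d y (\<pi> g)"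

lemma covers_comp:
  "g \<in> A \<Longrightarrow> h \<in> A \<Longrightarrow> covers y g \<Longrightarrow> covers z h \<Longrightarrow> covers (cl_mult d y z) (g \<circ> h)"
  using pin_covers_mult by (simp add: rep_comp)

lemma covers_id: "covers cl_one id"
  by (simp only: rep_id pin_covers_one)

lemma covers_exists: "g \<in> A \<Longrightarrow> \<exists>y. covers y g"
  using cartan_dieudonne rep_orth by blast

lemma covers_unique: "g \<in> A \<Longrightarrow> covers y g \<Longrightarrow> covers z g \<Longrightarrow> z = y \<or> z = cl_scale (-1) y"
  using pin_covers_eq rep_orth by blast

lemma covers_id_imp: "covers y id \<Longrightarrow> y = cl_one \<or> y = cl_scale (-1) cl_one"
  by (simp only: rep_id pin_covers_one_imp)

lemma covers_Pin: "covers y g \<Longrightarrow> y \<in> Pin d"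
  by (simp add: pin_covers_def)

text \<open>An odd y would have an odd cube, whereas the cube lies over the identity and is
  therefore 1 or -1, both even.\<close>

lemma covers_cube_even:
  assumes g: "g \<in> A" "g \<circ> (g \<circ> g) = id" and y: "covers y g"
  shows "cl_alpha y = y"
proof (rule ccontr)
  assume "cl_alpha y \<noteq> y"
  then have odd: "cl_alpha y = cl_scale (-1) y" using Pin_alpha[OF covers_Pin[OF y]] by blast
  define k where "k = cl_mult d y (cl_mult d y y)"
  have "covers k (g \<circ> (g \<circ> g))"
    unfolding k_def using g(1) y by (intro covers_comp A_comp)
  then have k: "covers k id" by (simp only: g(2))
  have "cl_alpha k = k"
    using covers_id_imp[OF k] by auto
  moreover have "cl_alpha k = cl_scale (-1) k"
    by (simp add: k_def cl_alpha_mult odd)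
  ultimately show False using Pin_scale_minus_one_neq[OF covers_Pin[OF k]] by simp
qed

lemma s1s3_A: "s1s3 \<in> A"
  using n by (rule s1s3_in_alt_group)

lemma s1s3_involution: "s1s3 \<circ> s1s3 = id"
  by (auto simp: s1s3_def transpose_def fun_eq_iff)

lemma covers_s1s3:
  obtains h x where "covers x s1s3" "(character \<pi> id - character \<pi> s1s3) / 2 = real h" "even h"
    "cl_mult d x x = cl_scale ((-1) ^ (\<Sum>{0..h})) cl_one"
proof -
  have "\<pi> s1s3 * \<pi> s1s3 = 1\<^sub>m d"
    using rep_comp[OF s1s3_A s1s3_A] by (simp only: s1s3_involution rep_id)
  then obtain h x where x: "covers x s1s3" "real d - mat_trace (\<pi> s1s3) = 2 * real h"
    "cl_alpha x = cl_scale ((-1) ^ h) x" "cl_mult d x x = cl_scale ((-1) ^ (\<Sum>{0..h})) cl_one"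
    using involution_cover[OF rep_orth[OF s1s3_A]] by blast
  \<comment> \<open>The factorisation (1 2)(3 4) = (1 2 3)(2 3 4).\<close>
  define a b where "a = transpose 1 (2::nat) \<circ> transpose 2 3" and "b = transpose 2 (3::nat) \<circ> transpose 3 4"
  have ab: "a \<circ> b = s1s3" "a \<circ> (a \<circ> a) = id" "b \<circ> (b \<circ> b) = id"
    by (auto simp: a_def b_def s1s3_def transpose_def fun_eq_iff)
  have A: "a \<in> A" "b \<in> A"
    using n by (simp_all add: a_def b_def alt_group_carrier evenperm_comp permutation_swap_id evenperm_swap
      permutes_compose permutes_swap_id)
  obtain y z where yz: "covers y a" "covers z b" using covers_exists A by blast
  have "covers (cl_mult d y z) s1s3"
    using covers_comp[OF A yz] by (simp only: ab)
  moreover have "cl_alpha (cl_mult d y z) = cl_mult d y z"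
    using covers_cube_even A ab yz by (simp add: cl_alpha_mult)
  moreover have "cl_mult d y z = x \<or> cl_mult d y z = cl_scale (-1) x"
    using covers_unique[OF s1s3_A x(1)] calculation(1) by blast
  ultimately have "cl_alpha x = x" by auto
  then have "even h"
    using x(3) Pin_scale_minus_one_neq[OF covers_Pin[OF x(1)]] by (cases "even h") auto
  moreover have "(character \<pi> id - character \<pi> s1s3) / 2 = real h"
    using x(2) by (simp add: character_def rep_id[unfolded id_def] id_def) (simp add: mat_trace_def)
  ultimately show ?thesis using that x by blast
qed

section \<open>Homomorphic lifts: uniqueness and existence\<close>

lemma is_pin_lift_iff:
  "is_pin_lift (alt_group n) d \<pi> f \<longleftrightarrow>
    (\<forall>g\<in>A. covers (f g) g) \<and> (\<forall>g\<in>A. \<forall>h\<in>A. f (g \<circ> h) = cl_mult d (f g) (f h))"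
proof -
  have "f g \<in> Pin d \<and> pin_rho d (f g) = \<pi> g \<longleftrightarrow> covers (f g) g" for g
    using pin_rho_eq_iff[of "f g" d] covers_Pin by blast
  then show ?thesis by (simp add: is_pin_lift_def alt_group_mult)
qed

lemma pin_lift_id:
  assumes "is_pin_lift (alt_group n) d \<pi> f"
  shows "f id = cl_one"
proof (rule Pin_idempotent)
  show "f id \<in> Pin d" using assms A_id by (auto simp: is_pin_lift_def)
  have "f (id \<circ> id) = cl_mult d (f id) (f id)"
    using assms A_id unfolding is_pin_lift_iff by blast
  then show "cl_mult d (f id) (f id) = f id" by simp
qed

lemma pin_lift_unique:
  assumes f1: "is_pin_lift (alt_group n) d \<pi> f1" and f2: "is_pin_lift (alt_group n) d \<pi> f2"
    and "g \<in> A"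
  shows "f1 g = f2 g"
proof -
  interpret monoid "alt_group n" by (rule alt_group_monoid)
  have mult: "f (g \<circ> h) = cl_mult d (f g) (f h)"
    if "is_pin_lift (alt_group n) d \<pi> f" "g \<in> A" "h \<in> A" for f g h
    using that unfolding is_pin_lift_iff by blast
  have gen: "f1 (cyc12 i) = f2 (cyc12 i)" if i: "3 \<le> i" "i \<le> n" for i
  proof -
    let ?c = "cyc12 i"
    have c: "?c \<in> A" using cyc12_in_alt_group[OF i] .
    then have cc: "?c \<circ> ?c \<in> A" by (intro A_comp)
    have c4: "(?c \<circ> ?c) \<circ> (?c \<circ> ?c) = ?c"
      using cyc12_cube[OF i(1)] by (auto simp: fun_eq_iff)
    have "f2 (?c \<circ> ?c) = f1 (?c \<circ> ?c) \<or> f2 (?c \<circ> ?c) = cl_scale (-1) (f1 (?c \<circ> ?c))"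
      using covers_unique[OF cc] f1 f2 cc unfolding is_pin_lift_iff by blast
    then have "cl_mult d (f2 (?c \<circ> ?c)) (f2 (?c \<circ> ?c)) = cl_mult d (f1 (?c \<circ> ?c)) (f1 (?c \<circ> ?c))"
      by auto
    then show ?thesis
      using mult[OF f1 cc cc] mult[OF f2 cc cc] by (simp only: c4)
  qed
  have "g \<in> words (alt_group n) cyc12 n" using \<open>g \<in> A\<close> by (rule alt_group_words)
  then show ?thesis
  proof (induction rule: words.induct)
    case one
    then show ?case using pin_lift_id[OF f1] pin_lift_id[OF f2] by (simp only: alt_group_one)
  next
    case (step w i)
    have "w \<in> A" using words_carrier[OF step(1)] cyc12_in_alt_group by blast
    then show ?case
      using step cyc12_in_alt_group[of i n] mult[OF f1, of w "cyc12 i"] mult[OF f2, of w "cyc12 i"] gen[of i]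
      by (simp only: alt_group_mult)
  qed
qed

text \<open>The pullback along \<open>\<pi>\<close> of the double cover \<open>Pin \<rightarrow> O\<close>; lifts of \<open>\<pi>\<close> are its splittings.\<close>
definition pullback :: "((nat \<Rightarrow> nat) \<times> cliff) monoid" where
  "pullback = \<lparr>carrier = {(g, y). g \<in> A \<and> covers y g},
     mult = (\<lambda>(g, y) (h, z). (g \<circ> h, cl_mult d y z)), one = (id, cl_one)\<rparr>"

lemma pullback_simps:
  "(g, y) \<in> carrier pullback \<longleftrightarrow> g \<in> A \<and> covers y g"
  "(g, y) \<otimes>\<^bsub>pullback\<^esub> (h, z) = (g \<circ> h, cl_mult d y z)"
  "\<one>\<^bsub>pullback\<^esub> = (id, cl_one)"
  by (simp_all only: pullback_def partial_object.simps monoid.simps mem_Collect_eq prod.case)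

lemma pullback_monoid: "monoid pullback"
proof (rule monoidI)
  show "\<one>\<^bsub>pullback\<^esub> \<in> carrier pullback"
    unfolding pullback_simps using A_id covers_id by blast
next
  fix p q assume "p \<in> carrier pullback" "q \<in> carrier pullback"
  then show "p \<otimes>\<^bsub>pullback\<^esub> q \<in> carrier pullback"
    by (cases p; cases q) (simp only: pullback_simps A_comp covers_comp)
next
  fix p q r
  show "p \<otimes>\<^bsub>pullback\<^esub> q \<otimes>\<^bsub>pullback\<^esub> r = p \<otimes>\<^bsub>pullback\<^esub> (q \<otimes>\<^bsub>pullback\<^esub> r)"
    by (cases p; cases q; cases r) (simp only: pullback_simps cl_mult_assoc o_assoc)
next
  fix p assume "p \<in> carrier pullback"
  then obtain g y where p: "p = (g, y)" and y: "y \<in> cl_carrier d"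
    by (cases p) (auto simp: pullback_simps dest!: covers_Pin Pin_carrier)
  show "\<one>\<^bsub>pullback\<^esub> \<otimes>\<^bsub>pullback\<^esub> p = p" "p \<otimes>\<^bsub>pullback\<^esub> \<one>\<^bsub>pullback\<^esub> = p"
    using y by (simp_all only: p pullback_simps cl_mult_one_left cl_mult_one_right id_o o_id)
qed

text \<open>If y is any lift of the 3-cycle c, then \<open>y\<^sup>3\<close> is 1 or -1. The fourth
  power of y lifts \<open>c\<^sup>4 = c\<close>, and its cube is the fourth power of
  \<open>y\<^sup>3\<close>, hence 1.\<close>

lemma covers_cyc12:
  assumes i: "3 \<le> i" "i \<le> n"
  shows "\<exists>y. covers y (cyc12 i) \<and> cl_mult d (cl_mult d y y) y = cl_one"
proof -
  let ?c = "cyc12 i"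
  have c: "?c \<in> A" using cyc12_in_alt_group[OF i] .
  have c3: "?c \<circ> (?c \<circ> ?c) = id" and c4: "(?c \<circ> ?c) \<circ> (?c \<circ> ?c) = ?c"
    using cyc12_cube[OF i(1)] by (auto simp: fun_eq_iff)
  obtain y where y: "covers y ?c" using covers_exists[OF c] by blast
  define k where "k = cl_mult d y (cl_mult d y y)"
  have "covers k (?c \<circ> (?c \<circ> ?c))"
    unfolding k_def using c y by (intro covers_comp A_comp)
  then have "k = cl_one \<or> k = cl_scale (-1) cl_one"
    using covers_id_imp by (simp only: c3)
  then have kk: "cl_mult d k k = cl_one" by auto
  have "covers (cl_mult d (cl_mult d y y) (cl_mult d y y)) ((?c \<circ> ?c) \<circ> (?c \<circ> ?c))"
    using c y by (intro covers_comp A_comp)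
  moreover have "cl_mult d (cl_mult d (cl_mult d (cl_mult d y y) (cl_mult d y y)) (cl_mult d (cl_mult d y y) (cl_mult d y y)))
      (cl_mult d (cl_mult d y y) (cl_mult d y y)) = cl_mult d (cl_mult d k k) (cl_mult d k k)"
    unfolding k_def by (simp only: cl_mult_assoc)
  ultimately show ?thesis
    using kk by (metis c4 cl_mult_one_left cl_one_carrier)
qed

text \<open>With z a lift of u, y agrees up to sign with the conjugate of x by z, and the sign is
  lost on squaring.\<close>

lemma covers_conj_involution:
  assumes x: "covers x s1s3" "cl_mult d x x = cl_one"
    and g: "g \<in> A" and u: "u \<in> A" and conj: "g \<circ> u = u \<circ> s1s3" and y: "covers y g"
  shows "cl_mult d y y = cl_one"
proof -
  obtain z where z: "covers z u" using covers_exists[OF u] by blast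
  have zP: "z \<in> Pin d" "y \<in> Pin d" using z y covers_Pin by auto
  define w where "w = cl_mult d (cl_mult d z x) (cl_star z)"
  have "covers (cl_mult d y z) (u \<circ> s1s3)"
    using covers_comp[OF g u y z] by (simp only: conj)
  then have "cl_mult d y z = cl_mult d z x \<or> cl_mult d y z = cl_scale (-1) (cl_mult d z x)"
    using covers_unique[OF A_comp[OF u s1s3_A] covers_comp[OF u s1s3_A z x(1)]] by blast
  moreover have "y = cl_mult d (cl_mult d y z) (cl_star z)"
    using zP by (simp add: cl_mult_assoc Pin_star_mult Pin_carrier)
  ultimately have "y = w \<or> y = cl_scale (-1) w"
    unfolding w_def by (metis cl_scale_simps(1))
  then have "cl_mult d y y = cl_mult d w w" by auto
  also have "\<dots> = cl_mult d z (cl_mult d (cl_mult d x (cl_mult d (cl_mult d (cl_star z) z) x)) (cl_star z))"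
    unfolding w_def by (simp only: cl_mult_assoc)
  also have "\<dots> = cl_one"
    using zP x covers_Pin[OF x(1)] by (simp add: Pin_star_mult Pin_star Pin_carrier)
  finally show ?thesis .
qed

text \<open>Order-3 lifts of the 3-cycles satisfy the relations in \<open>pullback\<close>, whatever
  choice is made, so its projection splits; the second component of the splitting is the
  lift.\<close>

lemma spinorial_of_involution:
  assumes x: "covers x s1s3" "cl_mult d x x = cl_one"
  shows "spinorial (alt_group n) d \<pi>"
proof -
  obtain C where C: "\<And>i. 3 \<le> i \<Longrightarrow> i \<le> n \<Longrightarrow>
      covers (C i) (cyc12 i) \<and> cl_mult d (cl_mult d (C i) (C i)) (C i) = cl_one"
    using covers_cyc12 by metis
  interpret P: monoid pullback by (rule pullback_monoid)
  interpret P: alt_cover pullback "\<lambda>i. (cyc12 i, C i)" n fst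
  proof
    fix i assume i: "3 \<le> i" "i \<le> n"
    have c: "cyc12 i \<in> A" using cyc12_in_alt_group[OF i] .
    show "(cyc12 i, C i) \<in> carrier pullback"
      unfolding pullback_simps using c C[OF i] by blast
    have "cyc12 i \<circ> cyc12 i \<circ> cyc12 i = id"
      using cyc12_cube[OF i(1)] by (auto simp: fun_eq_iff)
    then show "(cyc12 i, C i) \<otimes>\<^bsub>pullback\<^esub> (cyc12 i, C i) \<otimes>\<^bsub>pullback\<^esub> (cyc12 i, C i) = \<one>\<^bsub>pullback\<^esub>"
      unfolding pullback_simps using C[OF i] by blast
    show "fst (cyc12 i, C i) = cyc12 i" by simp
    fix j assume j: "3 \<le> j" "j \<le> n" and "i \<noteq> j"
    have cj: "cyc12 j \<in> A" using cyc12_in_alt_group[OF j] .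
    let ?g = "cyc12 i \<circ> cyc12 j"
    obtain u where u: "u \<in> A" "?g \<circ> u = u \<circ> s1s3"
      using cyc12_comp_cyc12_conj[OF n i j \<open>i \<noteq> j\<close>] .
    have "covers (cl_mult d (C i) (C j)) ?g"
      using covers_comp[OF c cj] C[OF i] C[OF j] by blast
    then have "cl_mult d (cl_mult d (C i) (C j)) (cl_mult d (C i) (C j)) = cl_one"
      using covers_conj_involution[OF x A_comp[OF c cj] u] by blast
    moreover have "?g \<circ> ?g = id"
      unfolding cyc12_comp_cyc12[OF i(1) j(1) \<open>i \<noteq> j\<close>]
      using i j \<open>i \<noteq> j\<close> by (auto simp: transpose_def fun_eq_iff)
    ultimately show "(cyc12 i, C i) \<otimes>\<^bsub>pullback\<^esub> (cyc12 j, C j) \<otimes>\<^bsub>pullback\<^esub>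
        ((cyc12 i, C i) \<otimes>\<^bsub>pullback\<^esub> (cyc12 j, C j)) = \<one>\<^bsub>pullback\<^esub>"
      unfolding pullback_simps by blast
  next
    fix p q
    show "fst (p \<otimes>\<^bsub>pullback\<^esub> q) = fst p \<circ> fst q"
      by (cases p; cases q) (simp only: pullback_simps fst_conv)
  next
    show "fst \<one>\<^bsub>pullback\<^esub> = id"
      by (simp only: pullback_simps fst_conv)
  qed
  obtain f where f: "\<And>g. g \<in> A \<Longrightarrow> f g \<in> carrier pullback \<and> fst (f g) = g"
    "\<And>g h. g \<in> A \<Longrightarrow> h \<in> A \<Longrightarrow> f (g \<circ> h) = f g \<otimes>\<^bsub>pullback\<^esub> f h"
    using P.alt_group_splitting by blast
  have "covers (snd (f g)) g" if "g \<in> A" for g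
    using f(1)[OF that] pullback_simps(1) by (metis prod.collapse)
  moreover have "snd (f (g \<circ> h)) = cl_mult d (snd (f g)) (snd (f h))" if "g \<in> A" "h \<in> A" for g h
    using f(2)[OF that] pullback_simps(2) by (metis prod.collapse snd_conv)
  ultimately have "is_pin_lift (alt_group n) d \<pi> (\<lambda>g. snd (f g))"
    unfolding is_pin_lift_iff by blast
  then show ?thesis unfolding spinorial_def by blast
qed

text \<open>The value of a homomorphic lift at \<open>s1s3\<close> squares to 1, and any other
  element over \<open>s1s3\<close> has the same square.\<close>

lemma involution_of_spinorial:
  assumes "spinorial (alt_group n) d \<pi>" and x: "covers x s1s3"
  shows "cl_mult d x x = cl_one"
proof -
  obtain f where f: "is_pin_lift (alt_group n) d \<pi> f" using assms by (auto simp: spinorial_def)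
  let ?y = "f s1s3"
  have "f (s1s3 \<circ> s1s3) = cl_mult d ?y ?y"
    using f s1s3_A unfolding is_pin_lift_iff by blast
  then have "cl_mult d ?y ?y = cl_one"
    by (simp only: s1s3_involution pin_lift_id[OF f])
  moreover have "x = ?y \<or> x = cl_scale (-1) ?y"
    using f s1s3_A x covers_unique unfolding is_pin_lift_iff by blast
  ultimately show ?thesis by auto
qed

theorem spinorial_iff:
  "spinorial (alt_group n) d \<pi> \<longleftrightarrow>
    (\<exists>k::int. (character \<pi> id - character \<pi> s1s3) / 2 = 4 * of_int k)"
proof -
  obtain h x where x: "covers x s1s3" and h: "(character \<pi> id - character \<pi> s1s3) / 2 = real h" "even h"
    and sq: "cl_mult d x x = cl_scale ((-1) ^ (\<Sum>{0..h})) cl_one"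
    using covers_s1s3 .
  have "spinorial (alt_group n) d \<pi> \<longleftrightarrow> cl_mult d x x = cl_one"
    using x spinorial_of_involution involution_of_spinorial by blast
  also have "\<dots> \<longleftrightarrow> even (\<Sum>{0..h})"
    using Pin_scale_minus_one_neq[OF Pin_one] unfolding sq by (cases "even (\<Sum>{0..h})") auto
  also have "\<dots> \<longleftrightarrow> 4 dvd h"
    using h(2) by (rule even_sum_atMost_iff)
  also have "\<dots> \<longleftrightarrow> (\<exists>k::int. real h = 4 * of_int k)"
  proof
    assume "4 dvd h"
    then obtain m where "h = 4 * m" by blast
    then have "real h = 4 * of_int (int m)" by simp
    then show "\<exists>k::int. real h = 4 * of_int k" by blast
  next
    assume "\<exists>k::int. real h = 4 * of_int k"
    then obtain k :: int where "real h = 4 * of_int k" by blast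
    then have "int h = 4 * k" by linarith
    then show "4 dvd h" by presburger
  qed
  finally show ?thesis unfolding h .
qed

end

theorem theorem4p1:
  fixes n d :: nat and \<pi> :: "(nat \<Rightarrow> nat) \<Rightarrow> real mat"
  assumes "n \<ge> 4"
    and "real_orth_rep (alt_group n) d \<pi>"
  shows "(spinorial (alt_group n) d \<pi> \<longleftrightarrow>
            (\<exists>k::int. (character \<pi> id - character \<pi> s1s3) / 2 = 4 * of_int k))
       \<and> (spinorial (alt_group n) d \<pi> \<longrightarrow>
            (\<forall>f1 f2. is_pin_lift (alt_group n) d \<pi> f1 \<and> is_pin_lift (alt_group n) d \<pi> f2
                \<longrightarrow> (\<forall>g\<in>carrier (alt_group n). f1 g = f2 g)))"
proof -
  interpret alt_rep n d \<pi> using assms by unfold_locales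
  show ?thesis using spinorial_iff pin_lift_unique by blast
qed

end
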